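(* Let $\xi$ be a (possibly killed) subordinator with Laplace exponent $\phi\not\equiv0$ and harmonic potential measure $H$, and let $R$ be the remainder random variable associated with its exponential functional. Let $(G^{(k)},k\ge1)$ be independent random variables such that $G^{(k)}$ is a copy of $G_{\mathbf{e}_k}$ for each $k\ge1$. Then for every $n\ge1$, $$\log R\stackrel{(d)}{=}-\gamma_\phi+\sum_{k=1}^n\left(\mathbf{E}[G^{(k)}]-G^{(k)}\right)+\log\frac{R_{(n)}}{\phi(n+1)}+B_n,$$ where $R_{(n)}$, the remainder random variable associated with the subordinator with Laplace exponent $\lambda\mapsto\phi(\lambda+n)$, $\lambda\ge0$, is independent of $(G^{(k)},1\le k\le n)$ and is such that $\log\frac{R_{(n)}}{\phi(n+1)}\to0$ in probability as $n\to\infty$; and $$B_n=\int_{(0,\infty)}H(dx)\,\frac{e^{-x}}{1-e^{-x}}\left(e^{-x}-1+x\right)e^{-nx}\xrightarrow[n\to\infty]{}0.$$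
   Context: A (possibly killed) subordinator $\xi$ is a $[0,\infty]$-valued Lévy process with non-decreasing paths, started at $0$, with absorbing state $+\infty$; convention $e^{-\infty}=0$. Its Laplace exponent is $\phi(\lambda)=-\log\mathbf{E}[e^{-\lambda\xi_1}]=q+\lambda a+\int_{(0,\infty)}(1-e^{-\lambda x})\Pi(dx)$, with killing term $q\ge0$, drift $a\ge0$ and Lévy measure $\Pi$ on $(0,\infty)$ with $\int(x\wedge1)\Pi(dx)<\infty$. The trivial case $\phi\equiv0$ is excluded. Harmonic potential measure: $H(dx)=\int_0^\infty\frac{dt}{t}\mathbf{P}(\xi_t\in dx)$ on $x\in(0,\infty)$. Remainder random variable: for a subordinator with Laplace exponent $\psi$, it is a positive random variable whose law is the (unique, moment-determinate) law with $n$-th moment $\prod_{i=1}^n\psi(i)$, $n\ge1$. $R$ corresponds to $\psi=\phi$, and $R_{(n)}$ to $\psi=\phi(\cdot+n)$. Last positions: for $t>0$, $L_t=\inf\{s>0:\xi_s>t\}$ and $G_t=\xi_{L_t-}$. For $k\ge1$, $\mathbf{e}_k$ is an exponential random variable with parameter $k$ independent of $\xi$, and $G_{\mathbf{e}_k}$ is $G_t$ at $t=\mathbf{e}_k$. Constant: $\gamma_\phi=\lim_{n\to\infty}\left(\sum_{j=1}^n\frac{\phi'(j)}{\phi(j)}-\log\phi(n)\right)$. The symbol $\stackrel{(d)}{=}$ denotes equality in distribution. *)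

theory Defs
  imports "HOL-Probability.Probability"
begin

text \<open>The library's \<^const>\<open>prob_space.indep_var\<close> needs both variables to have the same type.\<close>

definition indep_pair ::
    "'a measure \<Rightarrow> 'b measure \<Rightarrow> ('a \<Rightarrow> 'b) \<Rightarrow> 'c measure \<Rightarrow> ('a \<Rightarrow> 'c) \<Rightarrow> bool" where
  "indep_pair M S X T Y \<longleftrightarrow>
     X \<in> measurable M S \<and> Y \<in> measurable M T \<and>
     prob_space.indep_set M {X -` A \<inter> space M | A. A \<in> sets S} {Y -` A \<inter> space M | A. A \<in> sets T}"

text \<open>
  Paths take values in \<^typ>\<open>ennreal\<close> and are indexed by the times \<open>t \<ge> 0\<close>; the values at
  negative indices are irrelevant. The last clause is the Levy property for a killed process: on
  \<open>{\<xi>\<^sub>t < \<infinity>}\<close> the increment \<open>\<xi>\<^sub>t\<^sub>+\<^sub>s - \<xi>\<^sub>t\<close> is independent of the past \<open>(\<xi>\<^sub>u)\<^sub>0\<^sub>\<le>\<^sub>u\<^sub>\<le>\<^sub>t\<close> and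
  distributed as \<open>\<xi>\<^sub>s\<close>; here \<open>\<infinity> - x = \<infinity>\<close> for finite \<open>x\<close>, so that killing is part of the
  increment. Monotonicity makes \<open>\<infinity>\<close> absorbing and yields left limits.\<close>

definition subordinator :: "'a measure \<Rightarrow> (real \<Rightarrow> 'a \<Rightarrow> ennreal) \<Rightarrow> bool" where
  "subordinator M \<xi> \<longleftrightarrow>
     prob_space M \<and>
     (\<forall>t\<ge>0. \<xi> t \<in> borel_measurable M) \<and>
     (\<forall>\<omega>\<in>space M. \<xi> 0 \<omega> = 0 \<and> mono_on {0..} (\<lambda>t. \<xi> t \<omega>) \<and>
        (\<forall>t\<ge>0. continuous (at_right t) (\<lambda>s. \<xi> s \<omega>))) \<and>
     (\<forall>t\<ge>0. \<forall>s\<ge>0. \<forall>A\<in>sets (Pi\<^sub>M {0..t} (\<lambda>_. borel)). \<forall>B\<in>sets borel.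
        measure M {\<omega>\<in>space M. (\<lambda>u\<in>{0..t}. \<xi> u \<omega>) \<in> A \<and> \<xi> t \<omega> < \<infinity> \<and> \<xi> (t + s) \<omega> - \<xi> t \<omega> \<in> B}
        = measure M {\<omega>\<in>space M. (\<lambda>u\<in>{0..t}. \<xi> u \<omega>) \<in> A \<and> \<xi> t \<omega> < \<infinity>}
          * measure M {\<omega>\<in>space M. \<xi> s \<omega> \<in> B})"

text \<open>\<open>exp_neg \<lambda> x\<close> is \<open>e\<^sup>-\<^sup>\<lambda>\<^sup>x\<close> with \<open>e\<^sup>-\<^sup>\<infinity> = 0\<close>, also for \<open>\<lambda> = 0\<close>, so that
  \<open>laplace_exponent M \<xi> 0\<close> is the killing rate.\<close>

definition exp_neg :: "real \<Rightarrow> ennreal \<Rightarrow> real" where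
  "exp_neg l x = (if x = \<infinity> then 0 else exp (- l * enn2real x))"

definition laplace_exponent :: "'a measure \<Rightarrow> (real \<Rightarrow> 'a \<Rightarrow> ennreal) \<Rightarrow> real \<Rightarrow> real" where
  "laplace_exponent M \<xi> l = - ln (LINT \<omega>|M. exp_neg l (\<xi> 1 \<omega>))"

text \<open>A Borel measure on the real line, carried by \<open>(0,\<infinity>)\<close>.\<close>

definition harmonic_potential :: "'a measure \<Rightarrow> (real \<Rightarrow> 'a \<Rightarrow> ennreal) \<Rightarrow> real measure" where
  "harmonic_potential M \<xi> = measure_of UNIV (sets borel)
     (\<lambda>A. \<integral>\<^sup>+t\<in>{0<..}. ennreal (1 / t) *
            emeasure M {\<omega>\<in>space M. 0 < \<xi> t \<omega> \<and> \<xi> t \<omega> < \<infinity> \<and> enn2real (\<xi> t \<omega>) \<in> A} \<partial>lborel)"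

definition remainder_variable :: "'a measure \<Rightarrow> ('a \<Rightarrow> real) \<Rightarrow> (real \<Rightarrow> real) \<Rightarrow> bool" where
  "remainder_variable M R \<psi> \<longleftrightarrow>
     prob_space M \<and> R \<in> borel_measurable M \<and> (AE \<omega> in M. 0 < R \<omega>) \<and>
     (\<forall>n\<ge>1. has_bochner_integral M (\<lambda>\<omega>. R \<omega> ^ n) (\<Prod>i=1..n. \<psi> (real i)))"

text \<open>First passage times are \<^typ>\<open>ennreal\<close>-valued, with \<open>\<infinity>\<close> for a level that is never passed.\<close>

definition passage_time :: "(real \<Rightarrow> 'a \<Rightarrow> ennreal) \<Rightarrow> real \<Rightarrow> 'a \<Rightarrow> ennreal" where
  "passage_time \<xi> t \<omega> = Inf {ennreal s | s. s > 0 \<and> \<xi> s \<omega> > ennreal t}"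

definition last_position :: "(real \<Rightarrow> 'a \<Rightarrow> ennreal) \<Rightarrow> real \<Rightarrow> 'a \<Rightarrow> ennreal" where
  "last_position \<xi> t \<omega> = Lim (at_left (passage_time \<xi> t \<omega>)) (\<lambda>s. \<xi> (enn2real s) \<omega>)"

definition gamma_const :: "(real \<Rightarrow> real) \<Rightarrow> real" where
  "gamma_const \<phi> =
     lim (\<lambda>n. (\<Sum>j=1..n. deriv \<phi> (real j) / \<phi> (real j)) - ln (\<phi> (real n)))"

end

theory Submission
  imports Defs
begin

text \<open>
  Behind the identity in law is an identity of moments. The last position of the subordinator below an
  independent exponential level of rate \<open>k\<close> has Laplace transform \<open>s \<mapsto> \<phi>(k) / \<phi>(s + k)\<close>
  (\<open>laplace_transform_last_position\<close>). Hence the \<open>m\<close>-th moment of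
  \<open>R\<^sub>n exp(-(G\<^sub>1 + \<dots> + G\<^sub>n))\<close> is the product of \<open>\<phi>(n+1) \<dots> \<phi>(n+m)\<close> and of the factors
  \<open>\<phi>(k) / \<phi>(m+k)\<close> for \<open>k \<le> n\<close>. It telescopes to \<open>\<phi>(1) \<dots> \<phi>(m)\<close>, the \<open>m\<close>-th moment of \<open>R\<close>.
  As \<open>\<phi>(i) \<le> i \<phi>(1)\<close>, these moments are at most \<open>\<phi>(1)\<^sup>m m!\<close>, and nonnegative variables with such
  moments are determined by them (\<open>distr_eqI_moments\<close>): the equation of moments is one of laws.

  It remains to see that the constants on the right-hand side add up to zero. Differentiating the
  Laplace transform at \<open>0\<close> gives \<open>G\<^sub>k\<close> the mean \<open>\<phi>'(k) / \<phi>(k)\<close>. This is also the integral of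
  \<open>x e\<^sup>-\<^sup>k\<^sup>x\<close> against the harmonic potential measure, while \<open>e\<^sup>-\<^sup>k\<^sup>x - e\<^sup>-\<^sup>(\<^sup>k\<^sup>+\<^sup>1\<^sup>)\<^sup>x\<close> integrates to
  \<open>ln (\<phi>(k+1) / \<phi>(k))\<close>: in both cases the time integral \<open>dt/t\<close> is elementary because
  \<open>E e\<^sup>-\<^sup>\<lambda>\<^sup>\<xi>\<^sup>t = e\<^sup>-\<^sup>t\<^sup>\<phi>\<^sup>(\<^sup>\<lambda>\<^sup>)\<close>, the second being a Frullani integral. The integrand of
  \<open>B\<^sub>n - B\<^sub>n\<^sub>+\<^sub>1\<close> is the difference of these two at \<open>k = n + 1\<close>, so that
  \<open>\<Sum>k\<le>n. \<phi>'(k) / \<phi>(k) - ln \<phi>(n+1) + B\<^sub>n\<close> does not depend on \<open>n\<close>. As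
  \<open>0 \<le> B\<^sub>n \<le> \<phi>'(n+1) / \<phi>(n+1)\<close>, which tends to \<open>0\<close>, its value is \<open>\<gamma>\<^sub>\<phi>\<close>; in particular the limit
  defining \<open>\<gamma>\<^sub>\<phi>\<close> exists.

  Finally \<open>R\<^sub>n / \<phi>(n+1)\<close> has mean \<open>1\<close> and second moment \<open>\<phi>(n+2) / \<phi>(n+1)\<close>, which tends to \<open>1\<close>, so it
  tends to \<open>1\<close> in probability by Chebyshev's inequality.
\<close>

section \<open>Integrals over independent pairs\<close>

text \<open>Independence of two variables of different types passes to measurable functions of them. The form
  with functions lets the path of a process be replaced by its values at finitely many times.\<close>

lemma distr_pair_of_indep_pair:
  assumes P: "prob_space M" and ind: "indep_pair M S X T Y"
    and f[measurable]: "f \<in> measurable S S'" and g[measurable]: "g \<in> measurable T T'"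
  shows "distr M (S' \<Otimes>\<^sub>M T') (\<lambda>\<omega>. (f (X \<omega>), g (Y \<omega>))) =
    distr M S' (\<lambda>\<omega>. f (X \<omega>)) \<Otimes>\<^sub>M distr M T' (\<lambda>\<omega>. g (Y \<omega>))"
proof -
  interpret prob_space M by fact
  have X[measurable]: "X \<in> measurable M S" and Y[measurable]: "Y \<in> measurable M T"
    using ind by (auto simp: indep_pair_def)
  have fX: "(\<lambda>\<omega>. f (X \<omega>)) \<in> measurable M S'" and gY: "(\<lambda>\<omega>. g (Y \<omega>)) \<in> measurable M T'"
    by measurable
  interpret D1: prob_space "distr M S' (\<lambda>\<omega>. f (X \<omega>))" by (rule prob_space_distr) (rule fX)
  interpret D2: prob_space "distr M T' (\<lambda>\<omega>. g (Y \<omega>))" by (rule prob_space_distr) (rule gY)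
  show ?thesis
  proof (rule pair_measure_eqI[symmetric])
    fix A B assume A: "A \<in> sets (distr M S' (\<lambda>\<omega>. f (X \<omega>)))"
      and B: "B \<in> sets (distr M T' (\<lambda>\<omega>. g (Y \<omega>)))"
    define A' where "A' = f -` A \<inter> space S"
    define B' where "B' = g -` B \<inter> space T"
    have A'[measurable]: "A' \<in> sets S" and B'[measurable]: "B' \<in> sets T"
      using A B f g by (auto simp: A'_def B'_def intro: measurable_sets)
    have A1: "(\<lambda>\<omega>. f (X \<omega>)) -` A \<inter> space M = X -` A' \<inter> space M"
      using measurable_space[OF X] by (auto simp: A'_def)
    have B1: "(\<lambda>\<omega>. g (Y \<omega>)) -` B \<inter> space M = Y -` B' \<inter> space M"
      using measurable_space[OF Y] by (auto simp: B'_def)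
    have "prob ((X -` A' \<inter> space M) \<inter> (Y -` B' \<inter> space M)) =
      prob (X -` A' \<inter> space M) * prob (Y -` B' \<inter> space M)"
      using ind A' B' unfolding indep_pair_def indep_sets2_eq by blast
    then have "emeasure M ((X -` A' \<inter> space M) \<inter> (Y -` B' \<inter> space M)) =
      emeasure M (X -` A' \<inter> space M) * emeasure M (Y -` B' \<inter> space M)"
      by (simp add: emeasure_eq_measure ennreal_mult)
    moreover have "(\<lambda>\<omega>. (f (X \<omega>), g (Y \<omega>))) -` (A \<times> B) \<inter> space M =
      (X -` A' \<inter> space M) \<inter> (Y -` B' \<inter> space M)"
      using A1 B1 by auto
    ultimately show "emeasure (distr M S' (\<lambda>\<omega>. f (X \<omega>))) A * emeasure (distr M T' (\<lambda>\<omega>. g (Y \<omega>))) B =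
      emeasure (distr M (S' \<Otimes>\<^sub>M T') (\<lambda>\<omega>. (f (X \<omega>), g (Y \<omega>)))) (A \<times> B)"
      using A B fX gY by (simp add: emeasure_distr A1 B1 pair_measureI)
  qed (auto intro: D1.sigma_finite_measure_axioms D2.sigma_finite_measure_axioms cong: sets_pair_measure_cong)
qed

lemma nn_integral_of_indep_pair:
  assumes P: "prob_space M" and ind: "indep_pair M S X T Y"
    and f[measurable]: "f \<in> measurable S S'" and g[measurable]: "g \<in> measurable T T'"
    and F[measurable]: "F \<in> borel_measurable (S' \<Otimes>\<^sub>M T')"
  shows "(\<integral>\<^sup>+\<omega>. F (f (X \<omega>), g (Y \<omega>)) \<partial>M) =
    (\<integral>\<^sup>+\<omega>. (\<integral>\<^sup>+\<eta>. F (f (X \<omega>), g (Y \<eta>)) \<partial>M) \<partial>M)"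
proof -
  interpret prob_space M by fact
  have X[measurable]: "X \<in> measurable M S" and Y[measurable]: "Y \<in> measurable M T"
    using ind by (auto simp: indep_pair_def)
  interpret D2: prob_space "distr M T' (\<lambda>\<omega>. g (Y \<omega>))" by (rule prob_space_distr) measurable
  have "(\<integral>\<^sup>+\<omega>. F (f (X \<omega>), g (Y \<omega>)) \<partial>M) =
      (\<integral>\<^sup>+p. F p \<partial>(distr M (S' \<Otimes>\<^sub>M T') (\<lambda>\<omega>. (f (X \<omega>), g (Y \<omega>)))))"
    by (subst nn_integral_distr) auto
  also have "\<dots> = (\<integral>\<^sup>+p. F p \<partial>(distr M S' (\<lambda>\<omega>. f (X \<omega>)) \<Otimes>\<^sub>M distr M T' (\<lambda>\<omega>. g (Y \<omega>))))"
    by (simp add: distr_pair_of_indep_pair[OF P ind f g])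
  also have "\<dots> = (\<integral>\<^sup>+x. (\<integral>\<^sup>+y. F (x, y) \<partial>distr M T' (\<lambda>\<omega>. g (Y \<omega>))) \<partial>distr M S' (\<lambda>\<omega>. f (X \<omega>)))"
    by (subst D2.nn_integral_fst[symmetric]) auto
  also have "\<dots> = (\<integral>\<^sup>+x. (\<integral>\<^sup>+\<eta>. F (x, g (Y \<eta>)) \<partial>M) \<partial>distr M S' (\<lambda>\<omega>. f (X \<omega>)))"
    by (intro nn_integral_cong, subst nn_integral_distr) auto
  also have "\<dots> = (\<integral>\<^sup>+\<omega>. (\<integral>\<^sup>+\<eta>. F (f (X \<omega>), g (Y \<eta>)) \<partial>M) \<partial>M)"
    by (subst nn_integral_distr) (auto intro!: borel_measurable_nn_integral)
  finally show ?thesis .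
qed

section \<open>Moment determinacy under factorial growth\<close>

text \<open>The \<open>n\<close>-th derivative at \<open>t\<close> of the characteristic function, up to the factor \<open>\<i>\<^sup>n\<close>.\<close>

definition tilted_moment :: "real measure \<Rightarrow> nat \<Rightarrow> real \<Rightarrow> complex" where
  "tilted_moment \<mu> n t = (CLINT x|\<mu>. of_real (x ^ n) * iexp (t * x))"

text \<open>This is Taylor expansion of the derivatives of the characteristic function, with a radius of
  convergence that is the same around every point \<open>t\<close>: tilting by \<open>e\<^sup>i\<^sup>t\<^sup>x\<close> does not change absolute
  moments, so only the growth of the moments at \<open>0\<close> matters.\<close>

lemma (in real_distribution) tilted_moment_expansion:
  fixes m :: "nat \<Rightarrow> real"
  assumes nonneg: "AE x in M. 0 \<le> x"
    and moments: "\<And>n. has_bochner_integral M (\<lambda>x. x ^ n) (m n)"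
    and bound: "\<And>n. m n \<le> C ^ n * fact n" and C: "C > 0"
    and h: "\<bar>h\<bar> \<le> 1 / (4 * C)"
  shows "(\<lambda>j. (\<i> * h) ^ j / fact j * tilted_moment M (n + j) t) sums tilted_moment M n (t + h)"
proof -
  define f where "f j x = ((\<i> * h) ^ j / fact j) * (of_real (x ^ (n + j)) * iexp (t * x))" for j x
  have int_pow: "integrable M (\<lambda>x. x ^ k)" for k
    using moments[of k] by (auto simp: has_bochner_integral_iff)
  have int: "integrable M (\<lambda>x. of_real (x ^ k) * iexp (t * x) :: complex)" for k
    by (rule Bochner_Integration.integrable_bound[OF int_pow[of k]]) (auto simp: norm_mult simp del: of_real_power)
  have int_f: "integrable M (f j)" for j
    unfolding f_def[abs_def] by (intro integrable_mult_right int)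
  have norm_f: "norm (f j x) = \<bar>h\<bar> ^ j / fact j * \<bar>x\<bar> ^ (n + j)" for j x
    by (simp add: f_def norm_mult norm_divide norm_power power_abs)
  have abs_mom: "(LINT x|M. \<bar>x\<bar> ^ k) = m k" for k
  proof -
    have "(LINT x|M. \<bar>x\<bar> ^ k) = (LINT x|M. x ^ k)"
      by (rule integral_cong_AE) (use nonneg in auto)
    then show ?thesis using moments[of k] by (simp add: has_bochner_integral_iff)
  qed
  have int_norm: "(LINT x|M. norm (f j x)) \<le> (fact n * (2 * C) ^ n) * (1 / 2) ^ j" for j
  proof -
    \<comment> \<open>Bounding the binomial coefficient by \<open>2\<^sup>n\<^sup>+\<^sup>j\<close> separates \<open>n\<close> from \<open>j\<close>
      and leaves a geometric series in \<open>2 C \<bar>h\<bar> \<le> 1/2\<close>.\<close>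
    have "fact n * fact j * ((n + j) choose n) = (fact (n + j) :: nat)"
      using binomial_fact_lemma[of n "n + j"] by simp
    from arg_cong[OF this, of real] have "fact (n + j) = fact n * fact j * real ((n + j) choose n)"
      by (simp only: of_nat_mult of_nat_fact)
    also have "real ((n + j) choose n) \<le> 2 ^ (n + j)"
      using binomial_le_pow2[of "n + j" n] by (metis of_nat_le_iff of_nat_numeral of_nat_power)
    finally have fa: "fact (n + j) \<le> fact n * fact j * (2::real) ^ (n + j)"
      by (simp add: mult_left_mono)
    have "(LINT x|M. norm (f j x)) = \<bar>h\<bar> ^ j / fact j * m (n + j)"
      unfolding norm_f by (simp add: abs_mom)
    also have "\<dots> \<le> \<bar>h\<bar> ^ j / fact j * (C ^ (n + j) * fact (n + j))"
      by (intro mult_left_mono bound) auto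
    also have "\<dots> \<le> \<bar>h\<bar> ^ j / fact j * (C ^ (n + j) * (fact n * fact j * (2::real) ^ (n + j)))"
      by (intro mult_left_mono fa) (use C in auto)
    also have "\<dots> = (fact n * (2 * C) ^ n) * (2 * C * \<bar>h\<bar>) ^ j"
      by (simp add: power_add power_mult_distrib)
    also have "\<dots> \<le> (fact n * (2 * C) ^ n) * (1 / 2) ^ j"
      by (intro mult_left_mono power_mono) (use C h in \<open>auto simp: field_simps\<close>)
    finally show ?thesis .
  qed
  have summable_norm: "summable (\<lambda>j. LINT x|M. norm (f j x))"
    by (rule summable_comparison_test'[where N=0 and g="\<lambda>j. (fact n * (2 * C) ^ n) * (1 / 2) ^ j"])
      (use int_norm in \<open>auto intro!: summable_mult summable_geometric\<close>)
  have f_sums: "(\<lambda>j. f j x) sums (of_real (x ^ n) * iexp ((t + h) * x))" for x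
  proof -
    have "(\<lambda>j. (\<i> * h * x) ^ j /\<^sub>R fact j) sums exp (\<i> * h * x)"
      by (rule exp_converges)
    then have "(\<lambda>j. (of_real (x ^ n) * iexp (t * x)) * ((\<i> * h * x) ^ j /\<^sub>R fact j)) sums
        ((of_real (x ^ n) * iexp (t * x)) * exp (\<i> * h * x))"
      by (rule sums_mult)
    moreover have "(of_real (x ^ n) * iexp (t * x)) * ((\<i> * h * x) ^ j /\<^sub>R fact j) = f j x" for j
      by (simp add: f_def power_add power_mult_distrib scaleR_conv_of_real divide_simps)
    moreover have "(of_real (x ^ n) * iexp (t * x)) * exp (\<i> * h * x) =
        of_real (x ^ n) * iexp ((t + h) * x)"
      by (simp add: exp_add[symmetric] algebra_simps)
    ultimately show ?thesis by (simp only:)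
  qed
  have "AE x in M. summable (\<lambda>j. norm (f j x))"
  proof (rule AE_I2)
    fix x
    have "summable (\<lambda>j. \<bar>x\<bar> ^ n * ((\<bar>h\<bar> * \<bar>x\<bar>) ^ j /\<^sub>R fact j))"
      by (intro summable_mult summable_exp_generic)
    then show "summable (\<lambda>j. norm (f j x))"
      by (simp add: norm_f power_add power_mult_distrib divide_simps mult_ac)
  qed
  then have "(\<lambda>j. integral\<^sup>L M (f j)) sums (LINT x|M. (\<Sum>j. f j x))"
    using summable_norm by (intro sums_integral int_f)
  moreover have "(\<Sum>j. f j x) = of_real (x ^ n) * iexp ((t + h) * x)" for x
    using f_sums[of x] by (rule sums_unique[symmetric])
  moreover have "integral\<^sup>L M (f j) = (\<i> * h) ^ j / fact j * tilted_moment M (n + j) t" for j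
    unfolding f_def tilted_moment_def by (rule integral_mult_right_zero)
  ultimately show ?thesis
    by (simp add: tilted_moment_def)
qed

text \<open>Since the radius in the expansion is uniform, agreement of all derivatives of the two characteristic
  functions at \<open>0\<close> propagates along the line in steps of a fixed length.\<close>

lemma real_distribution_eqI_moments:
  fixes m :: "nat \<Rightarrow> real"
  assumes \<mu>: "real_distribution \<mu>" and \<nu>: "real_distribution \<nu>"
    and nonneg: "AE x in \<mu>. 0 \<le> x" "AE x in \<nu>. 0 \<le> x"
    and moments: "\<And>n. has_bochner_integral \<mu> (\<lambda>x. x ^ n) (m n)"
      "\<And>n. has_bochner_integral \<nu> (\<lambda>x. x ^ n) (m n)"
    and bound: "\<And>n. m n \<le> C ^ n * fact n" and C: "C > 0"
  shows "\<mu> = \<nu>"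
proof (rule Levy_uniqueness[OF \<mu> \<nu>])
  have step: "tilted_moment \<mu> n (real k * h) = tilted_moment \<nu> n (real k * h)"
    if h: "\<bar>h\<bar> \<le> 1 / (4 * C)" for n k h
  proof (induction k arbitrary: n)
    case 0
    show ?case
      using moments[of n] by (simp add: tilted_moment_def has_bochner_integral_iff del: of_real_power)
  next
    case (Suc k)
    note E = real_distribution.tilted_moment_expansion[OF _ _ _ bound C h, of _ n "real k * h"]
    have "(\<lambda>j. (\<i> * h) ^ j / fact j * tilted_moment \<nu> (n + j) (real k * h))
        sums tilted_moment \<mu> n (real k * h + h)"
      using E[OF \<mu> nonneg(1) moments(1)] by (simp only: Suc.IH)
    from sums_unique2[OF this E[OF \<nu> nonneg(2) moments(2)]]
    show ?case by (simp add: algebra_simps)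
  qed
  show "char \<mu> = char \<nu>"
  proof
    fix t :: real
    obtain k :: nat where k: "\<bar>t\<bar> * (4 * C) < real k" using reals_Archimedean2 by blast
    then have k0: "real k > 0" using C by (smt (verit) abs_ge_zero mult_nonneg_nonneg)
    have "\<bar>t / real k\<bar> \<le> 1 / (4 * C)"
      using k k0 C by (simp add: field_simps abs_divide)
    from step[OF this, of 0 k] k0 show "char \<mu> t = char \<nu> t"
      by (simp add: tilted_moment_def char_def)
  qed
qed

lemma distr_eqI_moments:
  fixes m :: "nat \<Rightarrow> real"
  assumes P: "prob_space P" and Q: "prob_space Q"
    and [measurable]: "X \<in> borel_measurable P" "Y \<in> borel_measurable Q"
    and nonneg: "AE \<omega> in P. 0 \<le> X \<omega>" "AE \<omega> in Q. 0 \<le> Y \<omega>"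
    and moments: "\<And>n. has_bochner_integral P (\<lambda>\<omega>. X \<omega> ^ n) (m n)"
      "\<And>n. has_bochner_integral Q (\<lambda>\<omega>. Y \<omega> ^ n) (m n)"
    and bound: "\<And>n. m n \<le> C ^ n * fact n" and C: "C > 0"
  shows "distr P borel X = distr Q borel Y"
proof (rule real_distribution_eqI_moments[OF _ _ _ _ _ _ bound C])
  show "real_distribution (distr P borel X)" "real_distribution (distr Q borel Y)"
    using P Q by (auto intro!: prob_space.real_distribution_distr)
  show "AE x in distr P borel X. 0 \<le> x" "AE x in distr Q borel Y. 0 \<le> x"
    using nonneg by (auto simp: AE_distr_iff)
  show "has_bochner_integral (distr P borel X) (\<lambda>x. x ^ n) (m n)"
    "has_bochner_integral (distr Q borel Y) (\<lambda>x. x ^ n) (m n)" for n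
    using moments[of n] by (auto intro!: has_bochner_integral_distr)
qed

section \<open>Laplace transforms of extended nonnegative variables\<close>

lemma exp_neg_measurable[measurable]: "exp_neg l \<in> borel_measurable borel"
  unfolding exp_neg_def[abs_def] by measurable

lemma exp_neg_nonneg[simp]: "0 \<le> exp_neg l x"
  by (simp add: exp_neg_def)

lemma exp_neg_le_1: "0 \<le> l \<Longrightarrow> exp_neg l x \<le> 1"
  by (simp add: exp_neg_def)

lemma exp_neg_top[simp]: "exp_neg l \<top> = 0"
  by (simp add: exp_neg_def)

lemma exp_neg_zero[simp]: "exp_neg l 0 = 1"
  by (simp add: exp_neg_def)

lemma exp_neg_add: "exp_neg l (x + y) = exp_neg l x * exp_neg l y"
  by (auto simp: exp_neg_def enn2real_plus less_top ring_distribs exp_add[symmetric] algebra_simps)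

lemma exp_neg_add_rate: "exp_neg (l + m) x = exp_neg l x * exp_neg m x"
  by (auto simp: exp_neg_def exp_add[symmetric] algebra_simps)

lemma exp_neg_power: "n \<ge> 1 \<Longrightarrow> exp_neg (real n) x = exp_neg 1 x ^ n"
  by (auto simp: exp_neg_def exp_of_nat_mult[symmetric])

lemma exp_neg_antimono: "0 \<le> l \<Longrightarrow> x \<le> y \<Longrightarrow> exp_neg l y \<le> exp_neg l x"
  by (auto simp: exp_neg_def less_top intro!: mult_left_mono enn2real_mono)

text \<open>The next two estimates bound the difference quotients of \<open>l \<mapsto> e\<^sup>-\<^sup>l\<^sup>x\<close> uniformly in \<open>x \<ge> 0\<close>.\<close>

lemma abs_exp_minus_1_le: "\<bar>exp y - 1\<bar> \<le> \<bar>y\<bar> * exp \<bar>y\<bar>" for y :: real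
proof (cases "0 \<le> y")
  case True
  have "(1 - y) * exp y \<le> exp (- y) * exp y"
    by (intro mult_right_mono) (use exp_ge_add_one_self[of "- y"] in auto)
  then show ?thesis using True by (simp add: exp_minus algebra_simps)
next
  case False
  have "1 - exp y \<le> - y" using exp_ge_add_one_self[of y] by linarith
  also have "\<dots> \<le> - y * exp (- y)" using False by simp
  finally show ?thesis using False by (simp add: abs_if)
qed

lemma mult_exp_neg_le: "x * exp (- l * x) \<le> 1 / l" if "0 < l" for x l :: real
proof -
  have "l * x * exp (- l * x) \<le> exp (l * x) * exp (- l * x)"
    by (intro mult_right_mono) (use exp_ge_add_one_self[of "l * x"] in \<open>linarith, auto\<close>)
  then show ?thesis using that by (simp add: exp_minus field_simps)
qed

lemma (in prob_space) integrable_exp_neg: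
  assumes [measurable]: "X \<in> borel_measurable M" and "0 \<le> l"
  shows "integrable M (\<lambda>\<omega>. exp_neg l (X \<omega>))"
  by (rule integrable_const_bound[where B=1]) (use assms exp_neg_le_1 in auto)

lemma (in prob_space) integrable_mult_exp_neg:
  assumes [measurable]: "X \<in> borel_measurable M" and l: "0 < l"
  shows "integrable M (\<lambda>\<omega>. enn2real (X \<omega>) * exp_neg l (X \<omega>))"
  by (rule integrable_const_bound[where B="1 / l"])
    (use l mult_exp_neg_le[OF l] in \<open>auto simp: exp_neg_def\<close>)

lemma (in prob_space) has_derivative_expectation_exp_neg:
  assumes [measurable]: "X \<in> borel_measurable M" and l: "0 < l"
  shows "((\<lambda>l. LINT \<omega>|M. exp_neg l (X \<omega>)) has_real_derivative
    - (LINT \<omega>|M. enn2real (X \<omega>) * exp_neg l (X \<omega>))) (at l)"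
  unfolding DERIV_def tendsto_at_iff_sequentially
proof (intro allI impI)
  fix u :: "nat \<Rightarrow> real" assume u: "\<forall>i. u i \<in> UNIV - {0}" "u \<longlonglongrightarrow> 0"
  from u(2) l have "\<forall>\<^sub>F n in sequentially. \<bar>u n\<bar> < l / 2"
    by (intro order_tendstoD(2)[where y=0] tendsto_rabs_zero) auto
  then obtain n0 where n0: "\<And>n. n \<ge> n0 \<Longrightarrow> \<bar>u n\<bar> < l / 2"
    by (auto simp: eventually_sequentially)
  \<comment> \<open>The dominating constant requires \<open>\<bar>u n\<bar> < l / 2\<close> for all \<open>n\<close>, so an initial segment is dropped.\<close>
  define v where "v n = u (n + n0)" for n
  have v: "\<bar>v n\<bar> < l / 2" "v n \<noteq> 0" for n using n0 u(1) by (auto simp: v_def)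
  have vlim: "v \<longlonglongrightarrow> 0" unfolding v_def using u(2) by (rule LIMSEQ_ignore_initial_segment)
  define q where "q n x = (exp_neg (l + v n) x - exp_neg l x) / v n" for n x
  have "(\<lambda>n. LINT \<omega>|M. q n (X \<omega>)) \<longlonglongrightarrow> (LINT \<omega>|M. - (enn2real (X \<omega>) * exp_neg l (X \<omega>)))"
  proof (rule integral_dominated_convergence[where w="\<lambda>_. 2 / l"])
    show "AE \<omega> in M. (\<lambda>n. q n (X \<omega>)) \<longlonglongrightarrow> - (enn2real (X \<omega>) * exp_neg l (X \<omega>))"
    proof (rule AE_I2)
      fix \<omega>
      define x where "x = enn2real (X \<omega>)"
      have "((\<lambda>s. exp (- s * x)) has_real_derivative - (x * exp (- l * x))) (at l)"
        by (auto intro!: derivative_eq_intros)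
      then have "((\<lambda>h. (exp (- (l + h) * x) - exp (- l * x)) / h) \<longlongrightarrow> - (x * exp (- l * x))) (at 0)"
        by (simp only: DERIV_def)
      then have "(\<lambda>n. (exp (- (l + v n) * x) - exp (- l * x)) / v n) \<longlonglongrightarrow> - (x * exp (- l * x))"
        by (rule filterlim_compose) (use v vlim in \<open>auto simp: filterlim_at\<close>)
      then show "(\<lambda>n. q n (X \<omega>)) \<longlonglongrightarrow> - (enn2real (X \<omega>) * exp_neg l (X \<omega>))"
        by (simp add: q_def exp_neg_def x_def)
    qed
    show "AE \<omega> in M. norm (q n (X \<omega>)) \<le> 2 / l" for n
    proof (rule AE_I2)
      fix \<omega>
      define x where "x = enn2real (X \<omega>)"
      have x: "0 \<le> x" by (simp add: x_def)
      have "exp (- (l + v n) * x) - exp (- l * x) = exp (- l * x) * (exp (- v n * x) - 1)"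
        by (simp add: exp_add[symmetric] algebra_simps)
      then have "\<bar>exp (- (l + v n) * x) - exp (- l * x)\<bar> = exp (- l * x) * \<bar>exp (- v n * x) - 1\<bar>"
        by (simp add: abs_mult)
      also have "\<dots> \<le> exp (- l * x) * (\<bar>- v n * x\<bar> * exp \<bar>- v n * x\<bar>)"
        by (intro mult_left_mono abs_exp_minus_1_le) auto
      also have "\<dots> = \<bar>v n\<bar> * (x * exp (- (l - \<bar>v n\<bar>) * x))"
        using x by (simp add: abs_mult exp_add[symmetric] algebra_simps)
      also have "\<dots> \<le> \<bar>v n\<bar> * (x * exp (- (l / 2) * x))"
      proof -
        have "- (l - \<bar>v n\<bar>) * x \<le> - (l / 2) * x"
          using x v(1)[of n] by (intro mult_right_mono) auto
        then show ?thesis using x by (intro mult_left_mono) auto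
      qed
      also have "\<dots> \<le> \<bar>v n\<bar> * (2 / l)"
        using mult_exp_neg_le[of "l / 2" x] l by (intro mult_left_mono) auto
      finally have "\<bar>exp (- (l + v n) * x) - exp (- l * x)\<bar> / \<bar>v n\<bar> \<le> 2 / l"
        using v(2)[of n] by (simp add: field_simps)
      then show "norm (q n (X \<omega>)) \<le> 2 / l"
        using l by (simp add: q_def exp_neg_def x_def abs_divide)
    qed
  qed (auto simp: q_def)
  moreover have "(LINT \<omega>|M. q n (X \<omega>)) =
      ((LINT \<omega>|M. exp_neg (l + v n) (X \<omega>)) - (LINT \<omega>|M. exp_neg l (X \<omega>))) / v n" for n
    using v(1)[of n] l by (simp add: q_def integrable_exp_neg Bochner_Integration.integral_diff)
  ultimately have "(\<lambda>n. ((LINT \<omega>|M. exp_neg (l + u (n + n0)) (X \<omega>)) - (LINT \<omega>|M. exp_neg l (X \<omega>))) / u (n + n0))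
      \<longlonglongrightarrow> - (LINT \<omega>|M. enn2real (X \<omega>) * exp_neg l (X \<omega>))"
    by (simp add: v_def)
  then show "((\<lambda>h. ((LINT \<omega>|M. exp_neg (l + h) (X \<omega>)) - (LINT \<omega>|M. exp_neg l (X \<omega>))) / h) \<circ> u)
      \<longlonglongrightarrow> - (LINT \<omega>|M. enn2real (X \<omega>) * exp_neg l (X \<omega>))"
    unfolding o_def by (rule LIMSEQ_offset)
qed

lemma one_minus_exp_quotient_tendsto:
  "((\<lambda>t. (1 - exp (- t * a)) / t) \<longlongrightarrow> a) (at_right 0)" for a :: real
proof -
  have "((\<lambda>t. - exp (- t * a)) has_real_derivative a) (at 0)"
    by (auto intro!: derivative_eq_intros)
  then show ?thesis by (auto simp: DERIV_def intro: tendsto_within_subset)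
qed

text \<open>Fatou's lemma along \<open>(1 - e\<^sup>-\<^sup>s\<^sup>X) / s \<le> X\<close> shows that the mean is finite; then \<open>X\<close> itself dominates
  these quotients, and their means converge to that of \<open>X\<close>.\<close>

lemma (in prob_space) has_bochner_integral_from_laplace:
  fixes X :: "'a \<Rightarrow> real"
  assumes [measurable]: "X \<in> borel_measurable M" and nonneg: "AE \<omega> in M. 0 \<le> X \<omega>"
    and laplace: "\<And>s. 0 < s \<Longrightarrow> (LINT \<omega>|M. exp (- s * X \<omega>)) = L s"
    and slope: "((\<lambda>s. (1 - L s) / s) \<longlongrightarrow> d) (at_right 0)"
  shows "has_bochner_integral M X d"
proof -
  define s where "s n = 1 / real (Suc n)" for n
  have s: "0 < s n" for n by (simp add: s_def)
  have s_lim: "filterlim s (at_right 0) sequentially"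
    unfolding filterlim_at s_def using LIMSEQ_inverse_real_of_nat by (simp add: inverse_eq_divide)
  define u where "u n \<omega> = (1 - exp (- s n * X \<omega>)) / s n" for n \<omega>
  have [measurable]: "u n \<in> borel_measurable M" for n unfolding u_def[abs_def] by measurable
  have u: "AE \<omega> in M. (\<forall>n. 0 \<le> u n \<omega> \<and> u n \<omega> \<le> X \<omega>) \<and> (\<lambda>n. u n \<omega>) \<longlonglongrightarrow> X \<omega>"
    using nonneg
  proof eventually_elim
    case (elim \<omega>)
    have "0 \<le> u n \<omega>" for n using elim s[of n] by (simp add: u_def)
    moreover have "u n \<omega> \<le> X \<omega>" for n
      using exp_ge_add_one_self[of "- s n * X \<omega>"] s[of n] by (simp add: u_def field_simps)
    moreover have "(\<lambda>n. u n \<omega>) \<longlonglongrightarrow> X \<omega>"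
      unfolding u_def by (rule filterlim_compose[OF one_minus_exp_quotient_tendsto s_lim])
    ultimately show ?case by blast
  qed
  have exp_int: "integrable M (\<lambda>\<omega>. exp (- s n * X \<omega>))" for n
    by (rule integrable_const_bound[where B=1]) (use nonneg s[of n] in \<open>auto elim!: eventually_mono\<close>)
  have u_int: "integrable M (u n)" and u_val: "(LINT \<omega>|M. u n \<omega>) = (1 - L (s n)) / s n" for n
    unfolding u_def using exp_int[of n] laplace[OF s[of n]] by (auto simp: prob_space)
  have u_lim: "(\<lambda>n. LINT \<omega>|M. u n \<omega>) \<longlonglongrightarrow> d"
    unfolding u_val by (rule filterlim_compose[OF slope s_lim])
  have u_nn: "(\<integral>\<^sup>+\<omega>. ennreal (u n \<omega>) \<partial>M) = ennreal (LINT \<omega>|M. u n \<omega>)" for n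
    by (intro nn_integral_eq_integral u_int) (use u in \<open>auto elim!: eventually_mono\<close>)
  have "(\<integral>\<^sup>+\<omega>. ennreal (X \<omega>) \<partial>M) = (\<integral>\<^sup>+\<omega>. liminf (\<lambda>n. ennreal (u n \<omega>)) \<partial>M)"
  proof (rule nn_integral_cong_AE)
    show "AE \<omega> in M. ennreal (X \<omega>) = liminf (\<lambda>n. ennreal (u n \<omega>))"
      using u by eventually_elim (auto intro!: lim_imp_Liminf[symmetric] tendsto_ennrealI)
  qed
  also have "\<dots> \<le> liminf (\<lambda>n. (\<integral>\<^sup>+\<omega>. ennreal (u n \<omega>) \<partial>M))"
    by (rule nn_integral_liminf) measurable
  also have "\<dots> = ennreal d"
    unfolding u_nn by (intro lim_imp_Liminf tendsto_ennrealI u_lim) simp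
  finally have "(\<integral>\<^sup>+\<omega>. ennreal (X \<omega>) \<partial>M) < \<infinity>" by (simp add: le_less_trans)
  then have X_int: "integrable M X"
    by (intro integrableI_nonneg nonneg) auto
  have "(\<lambda>n. LINT \<omega>|M. u n \<omega>) \<longlonglongrightarrow> (LINT \<omega>|M. X \<omega>)"
  proof (rule integral_dominated_convergence[where w=X])
    show "AE \<omega> in M. (\<lambda>n. u n \<omega>) \<longlonglongrightarrow> X \<omega>" "AE \<omega> in M. norm (u n \<omega>) \<le> X \<omega>" for n
      using u by (eventually_elim, simp)+
  qed (use X_int in auto)
  from LIMSEQ_unique[OF this u_lim] X_int show ?thesis by (simp add: has_bochner_integral_iff)
qed

section \<open>The Laplace exponent\<close>

text \<open>Comparing \<open>n t\<close> with the integers next to it bounds \<open>n \<bar>h t - t h 1\<bar>\<close> by \<open>h 1\<close> for every \<open>n\<close>.\<close>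

lemma additive_mono_imp_linear:
  fixes h :: "real \<Rightarrow> real"
  assumes add: "\<And>s t. 0 \<le> s \<Longrightarrow> 0 \<le> t \<Longrightarrow> h (t + s) = h t + h s"
    and mono: "\<And>s t. 0 \<le> s \<Longrightarrow> s \<le> t \<Longrightarrow> h s \<le> h t" and t: "0 \<le> t"
  shows "h t = t * h 1"
proof -
  have h0: "h 0 = 0" using add[of 0 0] by simp
  have hn: "h (real n * s) = real n * h s" if "0 \<le> s" for n s
    by (induction n) (use that add in \<open>auto simp: h0 algebra_simps\<close>)
  have h1: "0 \<le> h 1" using mono[of 0 1] h0 by simp
  have *: "\<bar>h t - t * h 1\<bar> * real n \<le> h 1" for n
  proof -
    define k where "k = nat \<lfloor>real n * t\<rfloor>"
    have "0 \<le> real n * t" using t by simp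
    then have k: "real k \<le> real n * t" "real n * t \<le> real k + 1"
      unfolding k_def by linarith+
    have "real k * h 1 \<le> real n * h t"
      using mono[of "real k" "real n * t"] k hn[of 1 k] hn[OF t, of n] by simp
    moreover have "real n * h t \<le> (real k + 1) * h 1"
      using mono[of "real n * t" "real (Suc k)"] k t hn[of 1 "Suc k"] hn[OF t, of n] by (simp add: add.commute)
    moreover have "real k * h 1 \<le> real n * t * h 1" "real n * t * h 1 \<le> (real k + 1) * h 1"
      using k h1 by (auto intro!: mult_right_mono)
    ultimately have "\<bar>real n * h t - real n * t * h 1\<bar> \<le> h 1"
      by (simp add: algebra_simps abs_le_iff)
    moreover have "real n * h t - real n * t * h 1 = (h t - t * h 1) * real n"
      by (simp add: algebra_simps)
    then have "\<bar>real n * h t - real n * t * h 1\<bar> = \<bar>h t - t * h 1\<bar> * real n"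
      by (simp add: abs_mult)
    ultimately show ?thesis by simp
  qed
  show ?thesis
  proof (rule ccontr)
    assume "h t \<noteq> t * h 1"
    then have "0 < \<bar>h t - t * h 1\<bar>" by simp
    then obtain n where "h 1 < real n * \<bar>h t - t * h 1\<bar>" using reals_Archimedean3 by blast
    with *[of n] show False by (simp add: mult.commute)
  qed
qed

locale subordinator_process = prob_space M for M :: "'a measure" +
  fixes \<xi> :: "real \<Rightarrow> 'a \<Rightarrow> ennreal"
  assumes subordinator: "subordinator M \<xi>"
begin

abbreviation \<phi> :: "real \<Rightarrow> real" where "\<phi> \<equiv> laplace_exponent M \<xi>"

lemma measurable_process[measurable]: "0 \<le> t \<Longrightarrow> \<xi> t \<in> borel_measurable M"
  using subordinator by (simp add: subordinator_def)

lemma process_zero: "\<omega> \<in> space M \<Longrightarrow> \<xi> 0 \<omega> = 0"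
  using subordinator by (simp add: subordinator_def)

lemma process_mono: "\<omega> \<in> space M \<Longrightarrow> 0 \<le> s \<Longrightarrow> s \<le> t \<Longrightarrow> \<xi> s \<omega> \<le> \<xi> t \<omega>"
  using subordinator by (auto simp: subordinator_def mono_on_def)

lemma process_right_continuous:
  "\<omega> \<in> space M \<Longrightarrow> 0 \<le> t \<Longrightarrow> ((\<lambda>s. \<xi> s \<omega>) \<longlongrightarrow> \<xi> t \<omega>) (at_right t)"
  using subordinator by (auto simp: subordinator_def continuous_within)

text \<open>The Levy property in terms of integrals. Killed paths are removed by the condition on \<open>f\<close>, which makes
  \<open>f (\<xi> t)\<close> vanish on them; on the remaining paths the pair formed by the position and the increment
  has a product law.\<close>

lemma nn_integral_increment:
  assumes t: "0 \<le> t" and s: "0 \<le> s"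
    and f[measurable]: "f \<in> borel_measurable borel" and h[measurable]: "h \<in> borel_measurable borel"
    and f_inf: "f \<top> = (0::ennreal)"
  shows "(\<integral>\<^sup>+\<omega>. f (\<xi> t \<omega>) * h (\<xi> (t + s) \<omega> - \<xi> t \<omega>) \<partial>M) =
    (\<integral>\<^sup>+\<omega>. f (\<xi> t \<omega>) \<partial>M) * (\<integral>\<^sup>+\<omega>. h (\<xi> s \<omega>) \<partial>M)"
proof -
  have [measurable]: "\<xi> t \<in> borel_measurable M" "\<xi> s \<in> borel_measurable M" "\<xi> (t + s) \<in> borel_measurable M"
    using t s by auto
  \<comment> \<open>The restriction of the measure to the paths that are alive at time \<open>t\<close>.\<close>
  define D where "D = density M (\<lambda>\<omega>. indicator {..<\<infinity>} (\<xi> t \<omega>))"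
  have D_em: "emeasure D {\<omega>\<in>space M. P \<omega>} = emeasure M {\<omega>\<in>space M. P \<omega> \<and> \<xi> t \<omega> < \<infinity>}"
    if [measurable]: "Measurable.pred M P" for P
    unfolding D_def by (subst emeasure_density)
      (auto simp flip: nn_integral_indicator intro!: nn_integral_cong split: split_indicator)
  have [measurable_cong, simp]: "sets D = sets M" "space D = space M" by (auto simp: D_def)
  have "finite_measure D"
    by (rule finite_measureI) (use D_em[of "\<lambda>_. True"] in simp)
  then interpret D: finite_measure D .
  interpret D1: finite_measure "distr D borel (\<xi> t)" by (rule D.finite_measure_distr) simp
  interpret D2: prob_space "distr M borel (\<xi> s)" by (rule prob_space_distr) simp
  have joint: "distr D borel (\<xi> t) \<Otimes>\<^sub>M distr M borel (\<xi> s) =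
      distr D (borel \<Otimes>\<^sub>M borel) (\<lambda>\<omega>. (\<xi> t \<omega>, \<xi> (t + s) \<omega> - \<xi> t \<omega>))"
  proof (rule pair_measure_eqI)
    fix A B assume "A \<in> sets (distr D borel (\<xi> t))" "B \<in> sets (distr M borel (\<xi> s))"
    then have A[measurable]: "A \<in> sets borel" and B[measurable]: "B \<in> sets borel" by auto
    define A' where "A' = {x \<in> space (Pi\<^sub>M {0..t} (\<lambda>_. borel)). x t \<in> A}"
    have [measurable]: "(\<lambda>x. x t) \<in> measurable (Pi\<^sub>M {0..t} (\<lambda>_. borel :: ennreal measure)) borel"
      by (rule measurable_component_singleton) (use t in simp)
    have A': "A' \<in> sets (Pi\<^sub>M {0..t} (\<lambda>_. borel :: ennreal measure))"
      unfolding A'_def by measurable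
    have mem: "(\<lambda>u\<in>{0..t}. \<xi> u \<omega>) \<in> A' \<longleftrightarrow> \<xi> t \<omega> \<in> A" for \<omega>
      using t by (auto simp: A'_def space_PiM)
    have "measure M {\<omega>\<in>space M. (\<lambda>u\<in>{0..t}. \<xi> u \<omega>) \<in> A' \<and> \<xi> t \<omega> < \<infinity> \<and> \<xi> (t + s) \<omega> - \<xi> t \<omega> \<in> B}
        = measure M {\<omega>\<in>space M. (\<lambda>u\<in>{0..t}. \<xi> u \<omega>) \<in> A' \<and> \<xi> t \<omega> < \<infinity>}
          * measure M {\<omega>\<in>space M. \<xi> s \<omega> \<in> B}"
      using subordinator t s A' B unfolding subordinator_def by blast
    then have "emeasure M {\<omega>\<in>space M. \<xi> t \<omega> \<in> A \<and> \<xi> t \<omega> < \<infinity>} * emeasure M {\<omega>\<in>space M. \<xi> s \<omega> \<in> B} =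
        emeasure M {\<omega>\<in>space M. (\<xi> t \<omega> \<in> A \<and> \<xi> (t + s) \<omega> - \<xi> t \<omega> \<in> B) \<and> \<xi> t \<omega> < \<infinity>}"
      unfolding mem by (simp add: emeasure_eq_measure ennreal_mult[symmetric] conj_ac)
    also have "\<dots> = emeasure D {\<omega>\<in>space M. \<xi> t \<omega> \<in> A \<and> \<xi> (t + s) \<omega> - \<xi> t \<omega> \<in> B}"
      by (rule D_em[symmetric]) measurable
    finally show "emeasure (distr D borel (\<xi> t)) A * emeasure (distr M borel (\<xi> s)) B =
        emeasure (distr D (borel \<Otimes>\<^sub>M borel) (\<lambda>\<omega>. (\<xi> t \<omega>, \<xi> (t + s) \<omega> - \<xi> t \<omega>))) (A \<times> B)"
      using D_em[of "\<lambda>\<omega>. \<xi> t \<omega> \<in> A"] by (simp add: emeasure_distr vimage_def Int_def conj_commute)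
  qed (auto intro: D1.sigma_finite_measure_axioms D2.sigma_finite_measure_axioms cong: sets_pair_measure_cong)
  have drop: "(\<integral>\<^sup>+\<omega>. f (\<xi> t \<omega>) * g \<omega> \<partial>M) = (\<integral>\<^sup>+\<omega>. f (\<xi> t \<omega>) * g \<omega> \<partial>D)"
    if [measurable]: "g \<in> borel_measurable M" for g
    unfolding D_def by (subst nn_integral_density)
      (auto simp: f_inf less_top[symmetric] intro!: nn_integral_cong split: split_indicator)
  have "(\<integral>\<^sup>+\<omega>. f (\<xi> t \<omega>) * h (\<xi> (t + s) \<omega> - \<xi> t \<omega>) \<partial>M) =
      (\<integral>\<^sup>+p. f (fst p) * h (snd p) \<partial>distr D (borel \<Otimes>\<^sub>M borel) (\<lambda>\<omega>. (\<xi> t \<omega>, \<xi> (t + s) \<omega> - \<xi> t \<omega>)))"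
    by (subst drop, simp, subst nn_integral_distr) auto
  also have "\<dots> = (\<integral>\<^sup>+x. (\<integral>\<^sup>+y. f x * h y \<partial>distr M borel (\<xi> s)) \<partial>distr D borel (\<xi> t))"
    unfolding joint[symmetric] by (subst D2.nn_integral_fst[symmetric]) auto
  also have "\<dots> = (\<integral>\<^sup>+x. f x \<partial>distr D borel (\<xi> t)) * (\<integral>\<^sup>+y. h y \<partial>distr M borel (\<xi> s))"
    by (simp add: nn_integral_cmult nn_integral_multc)
  also have "\<dots> = (\<integral>\<^sup>+\<omega>. f (\<xi> t \<omega>) \<partial>D) * (\<integral>\<^sup>+\<omega>. h (\<xi> s \<omega>) \<partial>M)"
    by (simp add: nn_integral_distr)
  finally show ?thesis using drop[of "\<lambda>_. 1"] by simp
qed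

text \<open>Writing \<open>\<xi>\<^sub>t\<^sub>+\<^sub>s\<close> as \<open>\<xi>\<^sub>t\<close> plus an independent increment moves the weight \<open>b\<close> to both summands.\<close>

lemma expectation_exp_neg_pair:
  assumes t: "0 \<le> t" and s: "0 \<le> s" and a: "0 \<le> a" and b: "0 \<le> b"
  shows "(LINT \<omega>|M. exp_neg a (\<xi> t \<omega>) * exp_neg b (\<xi> (t + s) \<omega>)) =
    (LINT \<omega>|M. exp_neg (a + b) (\<xi> t \<omega>)) * (LINT \<omega>|M. exp_neg b (\<xi> s \<omega>))"
proof -
  have [measurable]: "\<xi> t \<in> borel_measurable M" "\<xi> s \<in> borel_measurable M" "\<xi> (t + s) \<in> borel_measurable M"
    using t s by auto
  have eq: "exp_neg a (\<xi> t \<omega>) * exp_neg b (\<xi> (t + s) \<omega>) =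
      exp_neg (a + b) (\<xi> t \<omega>) * exp_neg b (\<xi> (t + s) \<omega> - \<xi> t \<omega>)" if "\<omega> \<in> space M" for \<omega>
  proof (cases "\<xi> t \<omega> = \<infinity>")
    case False
    have "\<xi> (t + s) \<omega> = \<xi> t \<omega> + (\<xi> (t + s) \<omega> - \<xi> t \<omega>)"
      using process_mono[OF that t, of "t + s"] s False
      by (metis add.commute add_increasing2 diff_add_cancel_ennreal le_add_same_cancel1)
    then have "exp_neg b (\<xi> (t + s) \<omega>) = exp_neg b (\<xi> t \<omega>) * exp_neg b (\<xi> (t + s) \<omega> - \<xi> t \<omega>)"
      by (metis exp_neg_add)
    then show ?thesis by (simp add: exp_neg_add_rate)
  qed simp
  have "ennreal (LINT \<omega>|M. exp_neg a (\<xi> t \<omega>) * exp_neg b (\<xi> (t + s) \<omega>)) =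
      (\<integral>\<^sup>+\<omega>. exp_neg a (\<xi> t \<omega>) * exp_neg b (\<xi> (t + s) \<omega>) \<partial>M)"
    by (intro nn_integral_eq_integral[symmetric] integrable_const_bound[where B=1])
      (use a b exp_neg_le_1 in \<open>auto intro!: mult_le_one\<close>)
  also have "\<dots> = (\<integral>\<^sup>+\<omega>. ennreal (exp_neg (a + b) (\<xi> t \<omega>)) * ennreal (exp_neg b (\<xi> (t + s) \<omega> - \<xi> t \<omega>)) \<partial>M)"
    by (intro nn_integral_cong) (simp add: eq ennreal_mult)
  also have "\<dots> = (\<integral>\<^sup>+\<omega>. ennreal (exp_neg (a + b) (\<xi> t \<omega>)) \<partial>M) * (\<integral>\<^sup>+\<omega>. ennreal (exp_neg b (\<xi> s \<omega>)) \<partial>M)"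
    by (rule nn_integral_increment[OF t s]) auto
  also have "\<dots> = ennreal (LINT \<omega>|M. exp_neg (a + b) (\<xi> t \<omega>)) * ennreal (LINT \<omega>|M. exp_neg b (\<xi> s \<omega>))"
    using a b by (intro arg_cong2[where f="(*)"] nn_integral_eq_integral integrable_exp_neg) auto
  finally show ?thesis
    by (simp add: ennreal_mult[symmetric])
qed

text \<open>The left-hand side is multiplicative in \<open>t\<close>, decreasing, and positive by right-continuity at \<open>0\<close>, so
  its logarithm is additive and monotone, hence linear.\<close>

lemma expectation_exp_neg:
  assumes l: "0 \<le> l" and t: "0 \<le> t"
  shows "(LINT \<omega>|M. exp_neg l (\<xi> t \<omega>)) = exp (- t * \<phi> l)"
proof -
  define g where "g t = (LINT \<omega>|M. exp_neg l (\<xi> t \<omega>))" for t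
  have mult: "g (t + s) = g t * g s" if "0 \<le> t" "0 \<le> s" for t s
  proof -
    \<comment> \<open>The factor \<open>exp_neg 0\<close> is the indicator of survival, which is implied by survival up to \<open>t + s\<close>.\<close>
    have "g (t + s) = (LINT \<omega>|M. exp_neg 0 (\<xi> t \<omega>) * exp_neg l (\<xi> (t + s) \<omega>))"
      unfolding g_def
    proof (rule Bochner_Integration.integral_cong[OF refl])
      fix \<omega> assume "\<omega> \<in> space M"
      from process_mono[OF this that(1), of "t + s"] that
      show "exp_neg l (\<xi> (t + s) \<omega>) = exp_neg 0 (\<xi> t \<omega>) * exp_neg l (\<xi> (t + s) \<omega>)"
        by (auto simp: exp_neg_def top_unique)
    qed
    then show ?thesis using expectation_exp_neg_pair[OF that, of 0 l] l by (simp add: g_def)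
  qed
  have g0: "g 0 = 1"
    unfolding g_def by (simp add: process_zero prob_space cong: Bochner_Integration.integral_cong)
  have nonneg: "0 \<le> g t" for t unfolding g_def by simp
  have anti: "g t \<le> g s" if "0 \<le> s" "s \<le> t" for s t
    unfolding g_def
    by (intro integral_mono integrable_exp_neg exp_neg_antimono process_mono) (use that l in auto)
  have lim: "(\<lambda>n. g (1 / real (Suc n))) \<longlonglongrightarrow> (LINT \<omega>|M. 1)"
    unfolding g_def
  proof (rule integral_dominated_convergence[where w="\<lambda>_. 1"])
    show "AE \<omega> in M. (\<lambda>n. exp_neg l (\<xi> (1 / real (Suc n)) \<omega>)) \<longlonglongrightarrow> 1"
    proof (rule AE_I2)
      fix \<omega> assume \<omega>: "\<omega> \<in> space M"
      have "filterlim (\<lambda>n. 1 / real (Suc n)) (at_right 0) sequentially"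
        unfolding filterlim_at using LIMSEQ_inverse_real_of_nat by (simp add: inverse_eq_divide)
      from filterlim_compose[OF process_right_continuous[OF \<omega>, of 0] this]
      have x: "(\<lambda>n. \<xi> (1 / real (Suc n)) \<omega>) \<longlonglongrightarrow> 0" by (simp add: process_zero[OF \<omega>])
      then have "\<forall>\<^sub>F n in sequentially. \<xi> (1 / real (Suc n)) \<omega> < \<infinity>"
        by (rule order_tendstoD) simp
      then have "\<forall>\<^sub>F n in sequentially. exp (- l * enn2real (\<xi> (1 / real (Suc n)) \<omega>)) =
          exp_neg l (\<xi> (1 / real (Suc n)) \<omega>)"
        by eventually_elim (auto simp: exp_neg_def)
      moreover have "(\<lambda>n. exp (- l * enn2real (\<xi> (1 / real (Suc n)) \<omega>))) \<longlonglongrightarrow> exp (- l * 0)"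
        by (intro tendsto_intros tendsto_enn2real) (use x in auto)
      ultimately show "(\<lambda>n. exp_neg l (\<xi> (1 / real (Suc n)) \<omega>)) \<longlonglongrightarrow> 1"
        by (subst (asm) tendsto_cong) auto
    qed
  qed (use l exp_neg_le_1 in auto)
  then have "\<forall>\<^sub>F n in sequentially. 0 < g (1 / real (Suc n))"
    by (rule order_tendstoD) (simp add: prob_space)
  then obtain n where n: "0 < g (1 / real (Suc n))"
    by (auto simp: eventually_sequentially)
  have pos_mult: "0 < g (real k * s)" if "0 < g s" "0 \<le> s" for k s
    by (induction k) (use that mult[of s "real k * s" for k] in \<open>auto simp: g0 algebra_simps\<close>)
  have g1: "0 < g 1" using pos_mult[OF n, of "Suc n"] by simp
  have pos: "0 < g t" if "0 \<le> t" for t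
  proof -
    obtain k :: nat where "t \<le> real k" using real_arch_simple by blast
    with pos_mult[OF g1, of k] anti[of t k] that show ?thesis by simp
  qed
  have "- ln (g t) = t * - ln (g 1)"
  proof (rule additive_mono_imp_linear[where h="\<lambda>t. - ln (g t)"])
    show "- ln (g (t + s)) = - ln (g t) + - ln (g s)" if "0 \<le> s" "0 \<le> t" for s t
      using pos[of s] pos[of t] that by (simp add: mult ln_mult)
  qed (use t pos anti in auto)
  then have "ln (g t) = - t * \<phi> l" by (simp add: g_def laplace_exponent_def)
  then show ?thesis using pos[OF t] by (simp add: g_def) (metis exp_ln)
qed

lemma laplace_exponent_nonneg: "0 \<le> l \<Longrightarrow> 0 \<le> \<phi> l"
proof -
  assume l: "0 \<le> l"
  have "(LINT \<omega>|M. exp_neg l (\<xi> 1 \<omega>)) \<le> (LINT \<omega>|M. 1)"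
    by (intro integral_mono integrable_exp_neg) (use l exp_neg_le_1 in auto)
  then show ?thesis using expectation_exp_neg[OF l, of 1] by (simp add: prob_space)
qed

lemma laplace_exponent_mono:
  assumes "0 \<le> l" "l \<le> m" shows "\<phi> l \<le> \<phi> m"
proof -
  have "(LINT \<omega>|M. exp_neg m (\<xi> 1 \<omega>)) \<le> (LINT \<omega>|M. exp_neg l (\<xi> 1 \<omega>))"
    by (intro integral_mono integrable_exp_neg)
      (use assms in \<open>auto simp: exp_neg_def intro!: mult_right_mono\<close>)
  then show ?thesis
    using expectation_exp_neg[of l 1] expectation_exp_neg[of m 1] assms by simp
qed

text \<open>If \<open>\<phi>\<close> vanished at a point \<open>m \<ge> 1\<close>, it would vanish at \<open>1\<close> by monotonicity, which forces
  \<open>\<xi>\<^sub>1 = 0\<close> almost surely and so \<open>\<phi> = 0\<close> everywhere.\<close>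

lemma laplace_exponent_pos:
  assumes nontrivial: "\<exists>l\<ge>0. \<phi> l \<noteq> 0" and m: "1 \<le> m"
  shows "0 < \<phi> m"
proof (rule ccontr)
  assume "\<not> 0 < \<phi> m"
  then have "\<phi> 1 = 0"
    using laplace_exponent_nonneg[of 1] laplace_exponent_mono[of 1 m] m by simp
  then have "(LINT \<omega>|M. 1 - exp_neg 1 (\<xi> 1 \<omega>)) = 0"
    using expectation_exp_neg[of 1 1] by (simp add: integrable_exp_neg prob_space)
  then have "AE \<omega> in M. 1 - exp_neg 1 (\<xi> 1 \<omega>) = 0"
    by (subst (asm) integral_nonneg_eq_0_iff_AE) (auto simp: integrable_exp_neg exp_neg_le_1)
  then have *: "AE \<omega> in M. \<xi> 1 \<omega> = 0"
    by eventually_elim (auto simp: exp_neg_def enn2real_eq_0_iff split: if_splits)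
  have "\<phi> l = 0" if "0 \<le> l" for l
  proof -
    have "(LINT \<omega>|M. exp_neg l (\<xi> 1 \<omega>)) = (LINT \<omega>|M. 1)"
      by (rule integral_cong_AE) (use * in auto)
    then show ?thesis using expectation_exp_neg[OF that, of 1] by (simp add: prob_space)
  qed
  with nontrivial show False by blast
qed

text \<open>Bernoulli's inequality gives \<open>1 - e\<^sup>-\<^sup>n\<^sup>x \<le> n (1 - e\<^sup>-\<^sup>x)\<close>; taking \<open>x = \<xi>\<^sub>t\<close>, dividing the expectations by
  \<open>t\<close> and letting \<open>t \<rightarrow> 0\<close> turns this into the claim. The linear bound is what makes the moments of
  the remainder variable grow no faster than \<open>C\<^sup>n n!\<close>.\<close>

lemma laplace_exponent_le_mult:
  assumes n: "1 \<le> n" shows "\<phi> (real n) \<le> real n * \<phi> 1"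
proof -
  have "(1 - exp (- t * \<phi> (real n))) / t \<le> real n * ((1 - exp (- t * \<phi> 1)) / t)" if t: "0 < t" for t
  proof -
    have "(LINT \<omega>|M. 1 - exp_neg (real n) (\<xi> t \<omega>)) \<le> (LINT \<omega>|M. real n * (1 - exp_neg 1 (\<xi> t \<omega>)))"
    proof (intro integral_mono)
      fix \<omega>
      show "1 - exp_neg (real n) (\<xi> t \<omega>) \<le> real n * (1 - exp_neg 1 (\<xi> t \<omega>))"
        using Bernoulli_inequality[of "exp_neg 1 (\<xi> t \<omega>) - 1" n]
        by (simp add: exp_neg_power[OF n] algebra_simps add_increasing)
    qed (use t in \<open>auto intro!: integrable_exp_neg\<close>)
    then show ?thesis
      using t by (simp add: integrable_exp_neg expectation_exp_neg prob_space divide_simps)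
  qed
  then show ?thesis
    by (intro tendsto_le[OF _ tendsto_mult_left[OF one_minus_exp_quotient_tendsto] one_minus_exp_quotient_tendsto])
      (auto simp: eventually_at_right_less intro: eventually_mono[OF eventually_at_right_less])
qed

lemma laplace_exponent_has_derivative:
  assumes l: "0 < l"
  shows "(\<phi> has_real_derivative deriv \<phi> l) (at l)"
proof -
  have *: "((\<lambda>l. LINT \<omega>|M. exp_neg l (\<xi> 1 \<omega>)) has_real_derivative
      - (LINT \<omega>|M. enn2real (\<xi> 1 \<omega>) * exp_neg l (\<xi> 1 \<omega>))) (at l)"
    by (rule has_derivative_expectation_exp_neg) (use l in auto)
  have "0 < (LINT \<omega>|M. exp_neg l (\<xi> 1 \<omega>))"
    using l by (simp add: expectation_exp_neg)
  from DERIV_minus[OF DERIV_chain2[where f=ln and g="\<lambda>l. LINT \<omega>|M. exp_neg l (\<xi> 1 \<omega>)" and x=l,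
      OF DERIV_ln[OF this] *]]
  have "(\<phi> has_real_derivative
     - (inverse (LINT \<omega>|M. exp_neg l (\<xi> 1 \<omega>)) * - (LINT \<omega>|M. enn2real (\<xi> 1 \<omega>) * exp_neg l (\<xi> 1 \<omega>)))) (at l)"
    unfolding laplace_exponent_def[abs_def] .
  then show ?thesis by (metis DERIV_imp_deriv)
qed

text \<open>Both sides are minus the derivative in \<open>l\<close> of \<open>E e\<^sup>-\<^sup>l\<^sup>\<xi>\<^sup>t = e\<^sup>-\<^sup>t\<^sup>\<phi>\<^sup>(\<^sup>l\<^sup>)\<close>.\<close>

lemma expectation_mult_exp_neg:
  assumes l: "0 < l" and t: "0 \<le> t"
  shows "(LINT \<omega>|M. enn2real (\<xi> t \<omega>) * exp_neg l (\<xi> t \<omega>)) = t * deriv \<phi> l * exp (- t * \<phi> l)"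
proof -
  have 1: "((\<lambda>l. LINT \<omega>|M. exp_neg l (\<xi> t \<omega>)) has_real_derivative
      - (LINT \<omega>|M. enn2real (\<xi> t \<omega>) * exp_neg l (\<xi> t \<omega>))) (at l)"
    by (rule has_derivative_expectation_exp_neg) (use l t in auto)
  have "((\<lambda>l. exp (- t * \<phi> l)) has_real_derivative exp (- t * \<phi> l) * (- t * deriv \<phi> l)) (at l)"
    by (auto intro!: derivative_eq_intros laplace_exponent_has_derivative[OF l])
  moreover have "\<forall>\<^sub>F m in nhds l. exp (- t * \<phi> m) = (LINT \<omega>|M. exp_neg m (\<xi> t \<omega>))"
    using eventually_nhds_in_open[of "{0<..}" l] l t
    by (auto elim!: eventually_mono simp: expectation_exp_neg)
  ultimately have "((\<lambda>l. LINT \<omega>|M. exp_neg l (\<xi> t \<omega>)) has_real_derivative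
      exp (- t * \<phi> l) * (- t * deriv \<phi> l)) (at l)"
    by (subst (asm) DERIV_cong_ev) auto
  from DERIV_unique[OF 1 this] show ?thesis by (simp add: algebra_simps)
qed

end

section \<open>Last positions below a level\<close>

lemma nonneg_rats_between:
  assumes "0 \<le> s" "ennreal s < p"
  obtains q r where "q \<in> \<rat>" "r \<in> \<rat>" "s < q" "q < r" "ennreal r < p"
proof -
  obtain z where z: "ennreal s < z" "z < p" using assms(2) dense by blast
  then have "z < \<top>" by (metis less_le_trans top_greatest)
  then have zr: "z = ennreal (enn2real z)" by simp
  then have "s < enn2real z"
    using z(1) assms(1) by (metis ennreal_less_iff)
  then obtain r where r: "r \<in> \<rat>" "s < r" "r < enn2real z" using Rats_dense_in_real by blast
  then obtain q where q: "q \<in> \<rat>" "s < q" "q < r" using Rats_dense_in_real by blast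
  have "ennreal r < z" by (subst zr, rule ennreal_lessI) (use r assms(1) in auto)
  with z that[of q r] q r show ?thesis by auto
qed

context subordinator_process
begin

lemma le_passage_time:
  assumes "\<omega> \<in> space M" "0 \<le> q" "\<xi> q \<omega> \<le> ennreal t"
  shows "ennreal q \<le> passage_time \<xi> t \<omega>"
  unfolding passage_time_def
proof (rule Inf_greatest)
  fix x assume "x \<in> {ennreal s |s. 0 < s \<and> ennreal t < \<xi> s \<omega>}"
  then obtain s where s: "x = ennreal s" "0 < s" "ennreal t < \<xi> s \<omega>" by auto
  have "\<not> s \<le> q"
  proof
    assume "s \<le> q"
    then have "\<xi> s \<omega> \<le> ennreal t" using process_mono[OF assms(1), of s q] s(2) assms(3) by simp
    with s(3) show False by simp
  qed
  then show "ennreal q \<le> x" using s by (simp add: ennreal_leI)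
qed

lemma process_le_before_passage:
  assumes "\<omega> \<in> space M" "0 \<le> s" "ennreal s < passage_time \<xi> t \<omega>"
  shows "\<xi> s \<omega> \<le> ennreal t"
proof (rule ccontr)
  assume *: "\<not> \<xi> s \<omega> \<le> ennreal t"
  then have "s \<noteq> 0" using process_zero[OF assms(1)] by auto
  then have "passage_time \<xi> t \<omega> \<le> ennreal s"
    unfolding passage_time_def by (intro Inf_lower) (use * assms(2) in \<open>auto simp: not_le\<close>)
  with assms(3) show False by simp
qed

text \<open>Paths are monotone, so the left limit at the passage time is the supremum before it. If that time
  is \<open>0\<close>, there is no left limit; for positive levels this does not happen, as paths start at \<open>0\<close> and
  are right-continuous.\<close>

lemma last_position_eq_SUP:
  assumes \<omega>: "\<omega> \<in> space M" and p: "0 < passage_time \<xi> t \<omega>"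
  shows "last_position \<xi> t \<omega> = (SUP s\<in>{s. 0 \<le> s \<and> ennreal s < passage_time \<xi> t \<omega>}. \<xi> s \<omega>)"
    (is "_ = (SUP s\<in>?S. _)")
proof -
  let ?p = "passage_time \<xi> t \<omega>"
  have fin: "u < \<top>" if "u < ?p" for u using that by (metis less_le_trans top_greatest)
  have "((\<lambda>u. \<xi> (enn2real u) \<omega>) \<longlongrightarrow> (SUP s\<in>?S. \<xi> s \<omega>)) (at_left ?p)"
  proof (rule increasing_tendsto)
    show "\<forall>\<^sub>F u in at_left ?p. \<xi> (enn2real u) \<omega> \<le> (SUP s\<in>?S. \<xi> s \<omega>)"
      unfolding eventually_at_left[OF p]
      by (intro exI[of _ 0] conjI p allI impI SUP_upper) (use fin in auto)
    fix x assume "x < (SUP s\<in>?S. \<xi> s \<omega>)"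
    then obtain s where s: "0 \<le> s" "ennreal s < ?p" "x < \<xi> s \<omega>" by (auto simp: less_SUP_iff)
    have "x < \<xi> (enn2real u) \<omega>" if u: "ennreal s < u" "u < ?p" for u
    proof -
      have "s \<le> enn2real u"
        using enn2real_mono[of "ennreal s" u] u fin s(1) by (simp add: less_imp_le)
      then show ?thesis using process_mono[OF \<omega> s(1)] s(3) by (metis less_le_trans)
    qed
    then show "\<forall>\<^sub>F u in at_left ?p. x < \<xi> (enn2real u) \<omega>"
      unfolding eventually_at_left[OF p] using s(2) by blast
  qed
  moreover have "at_left ?p \<noteq> bot"
    using eventually_at_left[OF p, of "\<lambda>_. False"] dense by (auto simp: trivial_limit_def)
  ultimately show ?thesis
    unfolding last_position_def by (intro tendsto_Lim) auto
qed

text \<open>The last position is the supremum of the positions at rational times \<open>q\<close> for which some later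
  rational time \<open>r\<close> still has \<open>\<xi> r \<le> E\<close>. The later time matters: a path that jumps to the level exactly at a
  rational time and leaves it at once would otherwise contribute its value after the jump.\<close>

lemma measurable_last_position:
  assumes [measurable]: "E \<in> borel_measurable M"
  shows "(\<lambda>\<omega>. last_position \<xi> (E \<omega>) \<omega>) \<in> borel_measurable M"
proof -
  define Q where "Q = {q::real. q \<in> \<rat> \<and> 0 \<le> q}"
  have Q: "countable Q" unfolding Q_def by (rule countable_subset[OF _ countable_rat]) auto
  have [measurable]: "\<xi> q \<in> borel_measurable M" if "q \<in> Q" for q using that by (auto simp: Q_def)
  \<comment> \<open>At passage time \<open>0\<close> the filter of left neighbourhoods is trivial, so every value is a limit
    and \<open>Lim\<close> picks a value that does not depend on the path.\<close>
  define junk where "junk = (THE l::ennreal. True)"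
  have pos_iff: "0 < passage_time \<xi> t \<omega> \<longleftrightarrow> (\<exists>q\<in>Q. 0 < q \<and> \<xi> q \<omega> \<le> ennreal t)"
    if \<omega>: "\<omega> \<in> space M" for \<omega> t
  proof
    assume "0 < passage_time \<xi> t \<omega>"
    then obtain q r where "q \<in> \<rat>" "r \<in> \<rat>" "0 < q" "q < r" "ennreal r < passage_time \<xi> t \<omega>"
      using nonneg_rats_between[of 0 "passage_time \<xi> t \<omega>"] by auto
    then show "\<exists>q\<in>Q. 0 < q \<and> \<xi> q \<omega> \<le> ennreal t"
      using process_le_before_passage[OF \<omega>, of r t] by (intro bexI[of _ r]) (auto simp: Q_def)
  next
    assume "\<exists>q\<in>Q. 0 < q \<and> \<xi> q \<omega> \<le> ennreal t"
    then obtain q where q: "0 < q" "\<xi> q \<omega> \<le> ennreal t" by auto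
    from q(1) have "0 < ennreal q" by simp
    also have "\<dots> \<le> passage_time \<xi> t \<omega>" using le_passage_time[OF \<omega>] q by simp
    finally show "0 < passage_time \<xi> t \<omega>" .
  qed
  have eq: "last_position \<xi> t \<omega> =
      (if \<exists>q\<in>Q. 0 < q \<and> \<xi> q \<omega> \<le> ennreal t
       then SUP q\<in>Q. SUP r\<in>Q. if q < r \<and> \<xi> r \<omega> \<le> ennreal t then \<xi> q \<omega> else 0 else junk)"
    if \<omega>: "\<omega> \<in> space M" for \<omega> t
  proof (cases "0 < passage_time \<xi> t \<omega>")
    case True
    let ?S = "{s. 0 \<le> s \<and> ennreal s < passage_time \<xi> t \<omega>}"
    have "(SUP s\<in>?S. \<xi> s \<omega>) = (SUP q\<in>Q. SUP r\<in>Q. if q < r \<and> \<xi> r \<omega> \<le> ennreal t then \<xi> q \<omega> else 0)"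
    proof (rule antisym)
      show "(SUP s\<in>?S. \<xi> s \<omega>) \<le> (SUP q\<in>Q. SUP r\<in>Q. if q < r \<and> \<xi> r \<omega> \<le> ennreal t then \<xi> q \<omega> else 0)"
      proof (rule SUP_least)
        fix s assume "s \<in> ?S"
        then obtain q r where qr: "q \<in> \<rat>" "r \<in> \<rat>" "0 \<le> s" "s < q" "q < r" "ennreal r < passage_time \<xi> t \<omega>"
          using nonneg_rats_between[of s "passage_time \<xi> t \<omega>"] by auto
        have "\<xi> s \<omega> \<le> \<xi> q \<omega>" using process_mono[OF \<omega>] qr by auto
        also have "\<dots> = (if q < r \<and> \<xi> r \<omega> \<le> ennreal t then \<xi> q \<omega> else 0)"
          using process_le_before_passage[OF \<omega> _ qr(6)] qr by auto
        also have "\<dots> \<le> (SUP q\<in>Q. SUP r\<in>Q. if q < r \<and> \<xi> r \<omega> \<le> ennreal t then \<xi> q \<omega> else 0)"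
          by (rule SUP_upper2[of q], use qr in \<open>simp add: Q_def\<close>, rule SUP_upper2[of r])
            (use qr in \<open>auto simp: Q_def\<close>)
        finally show "\<xi> s \<omega> \<le> \<dots>" .
      qed
      show "(SUP q\<in>Q. SUP r\<in>Q. if q < r \<and> \<xi> r \<omega> \<le> ennreal t then \<xi> q \<omega> else 0) \<le> (SUP s\<in>?S. \<xi> s \<omega>)"
      proof (intro SUP_least)
        fix q r assume "q \<in> Q" "r \<in> Q"
        then have "0 \<le> q" "0 \<le> r" by (auto simp: Q_def)
        show "(if q < r \<and> \<xi> r \<omega> \<le> ennreal t then \<xi> q \<omega> else 0) \<le> (SUP s\<in>?S. \<xi> s \<omega>)"
        proof (cases "q < r \<and> \<xi> r \<omega> \<le> ennreal t")
          case True
          have "ennreal q < ennreal r" using True \<open>0 \<le> q\<close> by (simp add: ennreal_lessI)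
          also have "\<dots> \<le> passage_time \<xi> t \<omega>" using le_passage_time[OF \<omega> \<open>0 \<le> r\<close>] True by simp
          finally show ?thesis using True \<open>0 \<le> q\<close> by (auto intro!: SUP_upper)
        next
          case False
          then show ?thesis by (simp only: if_False zero_le)
        qed
      qed
    qed
    then show ?thesis using True pos_iff[OF \<omega>] last_position_eq_SUP[OF \<omega> True] by simp
  next
    case False
    then have "passage_time \<xi> t \<omega> = 0" by simp
    moreover have "at_left (0::ennreal) = bot"
      by (simp add: at_within_def lessThan_def)
    ultimately have "last_position \<xi> t \<omega> = junk"
      by (simp add: last_position_def Topological_Spaces.Lim_def junk_def)
    then show ?thesis using False pos_iff[OF \<omega>] by auto
  qed
  have [measurable]: "(\<lambda>\<omega>. SUP q\<in>Q. SUP r\<in>Q. if q < r \<and> \<xi> r \<omega> \<le> ennreal (E \<omega>) then \<xi> q \<omega> else 0)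
      \<in> borel_measurable M"
    by (intro borel_measurable_SUP Q) measurable
  have "(\<lambda>\<omega>. SUP q\<in>Q. if 0 < q \<and> \<xi> q \<omega> \<le> ennreal (E \<omega>) then 1 else 0 :: ennreal) \<in> borel_measurable M"
    by (intro borel_measurable_SUP Q) measurable
  then have "Measurable.pred M (\<lambda>\<omega>. 0 < (SUP q\<in>Q. if 0 < q \<and> \<xi> q \<omega> \<le> ennreal (E \<omega>) then 1 else 0 :: ennreal))"
    by measurable
  also have "(\<lambda>\<omega>. 0 < (SUP q\<in>Q. if 0 < q \<and> \<xi> q \<omega> \<le> ennreal (E \<omega>) then 1 else 0 :: ennreal)) =
      (\<lambda>\<omega>. \<exists>q\<in>Q. 0 < q \<and> \<xi> q \<omega> \<le> ennreal (E \<omega>))"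
    unfolding less_SUP_iff by (auto split: if_splits)
  finally have [measurable]: "Measurable.pred M (\<lambda>\<omega>. \<exists>q\<in>Q. 0 < q \<and> \<xi> q \<omega> \<le> ennreal (E \<omega>))" .
  have "(\<lambda>\<omega>. if \<exists>q\<in>Q. 0 < q \<and> \<xi> q \<omega> \<le> ennreal (E \<omega>)
       then SUP q\<in>Q. SUP r\<in>Q. if q < r \<and> \<xi> r \<omega> \<le> ennreal (E \<omega>) then \<xi> q \<omega> else 0 else junk)
      \<in> borel_measurable M"
    by measurable
  then show ?thesis by (subst measurable_cong[OF eq]) auto
qed

text \<open>On the grid with mesh \<open>1/(n+1)\<close> the level is crossed between the times \<open>j n/(n+1)\<close> and
  \<open>(j n + 1)/(n+1)\<close>, which enclose the passage time; the position at the first of them is therefore close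
  to the left limit there. Exact hits of the level at rational times are excluded, since a path can
  reach the level and stay there for a while before it passes it.\<close>

lemma grid_position_tendsto:
  assumes \<omega>: "\<omega> \<in> space M" and t: "0 < t"
    and avoid: "\<And>q. q \<in> \<rat> \<Longrightarrow> 0 \<le> q \<Longrightarrow> \<xi> q \<omega> \<noteq> ennreal t"
    and j: "\<And>n. \<xi> (real (j n) / real (Suc n)) \<omega> < ennreal t"
      "\<And>n. ennreal t \<le> \<xi> (real (Suc (j n)) / real (Suc n)) \<omega>"
  shows "(\<lambda>n. \<xi> (real (j n) / real (Suc n)) \<omega>) \<longlonglongrightarrow> last_position \<xi> t \<omega>"
    and "last_position \<xi> t \<omega> \<le> ennreal t"
proof -
  let ?p = "passage_time \<xi> t \<omega>"
  let ?S = "{s. 0 \<le> s \<and> ennreal s < ?p}"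
  have before: "ennreal s < ?p" if s: "0 \<le> s" "\<xi> s \<omega> < ennreal t" for s
  proof -
    have "\<forall>\<^sub>F u in at_right s. \<xi> u \<omega> < ennreal t"
      using process_right_continuous[OF \<omega> s(1)] s(2) by (rule order_tendstoD)
    then obtain b where b: "s < b" "\<And>u. s < u \<Longrightarrow> u < b \<Longrightarrow> \<xi> u \<omega> < ennreal t"
      unfolding eventually_at_right[OF less_add_one] by auto
    obtain u where u: "s < u" "u < b" using dense b(1) by blast
    have "ennreal s < ennreal u" using u s by (simp add: ennreal_lessI)
    also have "\<dots> \<le> ?p" using le_passage_time[OF \<omega>, of u t] b(2)[OF u] u s by simp
    finally show ?thesis .
  qed
  have "0 < ?p" using before[of 0] t by (simp add: process_zero[OF \<omega>])
  note G = last_position_eq_SUP[OF \<omega> this]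
  show "last_position \<xi> t \<omega> \<le> ennreal t"
    unfolding G by (intro SUP_least) (use process_le_before_passage[OF \<omega>] in auto)
  show "(\<lambda>n. \<xi> (real (j n) / real (Suc n)) \<omega>) \<longlonglongrightarrow> last_position \<xi> t \<omega>"
    unfolding G
  proof (rule increasing_tendsto)
    show "\<forall>\<^sub>F n in sequentially. \<xi> (real (j n) / real (Suc n)) \<omega> \<le> (SUP s\<in>?S. \<xi> s \<omega>)"
      by (intro always_eventually allI SUP_upper) (use before j in auto)
    fix x assume "x < (SUP s\<in>?S. \<xi> s \<omega>)"
    then obtain s where s: "0 \<le> s" "ennreal s < ?p" "x < \<xi> s \<omega>" by (auto simp: less_SUP_iff)
    obtain q r where qr: "s < q" "q < r" "ennreal r < ?p" using nonneg_rats_between[OF s(1,2)] by metis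
    have "\<forall>\<^sub>F n in sequentially. 1 / real (Suc n) < r - s"
      by (rule order_tendstoD(2)[OF LIMSEQ_Suc[OF lim_1_over_n]]) (use qr in auto)
    then show "\<forall>\<^sub>F n in sequentially. x < \<xi> (real (j n) / real (Suc n)) \<omega>"
    proof eventually_elim
      case (elim n)
      let ?v = "real (Suc (j n)) / real (Suc n)"
      have "ennreal t < \<xi> ?v \<omega>" using j(2)[of n] avoid[of ?v] by (simp add: order.strict_iff_order)
      then have "?p \<le> ennreal ?v"
        unfolding passage_time_def by (intro Inf_lower) auto
      then have "ennreal r < ennreal ?v" using qr(3) by (rule less_le_trans[rotated])
      then have "r < ?v" using qr s by (simp add: ennreal_less_iff)
      moreover have "?v = real (j n) / real (Suc n) + 1 / real (Suc n)"
        by (simp add: add_divide_distrib)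
      ultimately have "s \<le> real (j n) / real (Suc n)" using elim by linarith
      from process_mono[OF \<omega> s(1) this] s(3) show ?case by (rule less_le_trans[rotated])
    qed
  qed
qed

end

section \<open>The last position below an exponential level\<close>

text \<open>The exponential law is used through \<open>P(a < E) = exp_neg \<kappa> a\<close>: integrating out the level turns the
  event that a position lies below it into a weight that is multiplicative in the position.\<close>

locale subordinator_exponential_level = subordinator_process +
  fixes \<kappa> :: real and E :: "'a \<Rightarrow> real"
  assumes rate_pos: "0 < \<kappa>"
    and exponential_level: "distributed M lborel E (exponential_density \<kappa>)"
    and indep_level: "indep_pair M (Pi\<^sub>M {0..} (\<lambda>_. borel)) (\<lambda>\<omega>. \<lambda>t\<in>{0..}. \<xi> t \<omega>) borel E"
begin

lemma measurable_level[measurable]: "E \<in> borel_measurable M"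
  using indep_level by (simp add: indep_pair_def)

lemma AE_level_pos: "AE \<omega> in M. 0 < E \<omega>"
proof -
  have "prob {\<omega> \<in> space M. 0 < E \<omega>} = 1"
    using exponential_distributedD_gt[OF exponential_level, of 0] rate_pos by simp
  then show ?thesis by (subst (asm) prob_Collect_eq_1) auto
qed

lemma AE_level_neq: "AE \<omega> in M. E \<omega> \<noteq> r"
proof -
  have "emeasure (distr M lborel E) {r} = emeasure (density lborel (exponential_density \<kappa>)) {r}"
    using exponential_level by (simp add: distributed_def)
  also have "\<dots> = 0" by (subst emeasure_density) (auto intro!: nn_integral_null_set)
  finally have "emeasure M (E -` {r} \<inter> space M) = 0" by (simp add: emeasure_distr)
  then show ?thesis by (intro AE_I[where N="E -` {r} \<inter> space M"]) auto
qed

lemma nn_integral_level_greater: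
  "(\<integral>\<^sup>+\<omega>. (if a < ennreal (E \<omega>) then 1 else 0) \<partial>M) = ennreal (exp_neg \<kappa> a)"
proof (cases a)
  case (real r)
  have "(\<integral>\<^sup>+\<omega>. (if a < ennreal (E \<omega>) then 1 else 0) \<partial>M) = (\<integral>\<^sup>+\<omega>. indicator {\<omega>\<in>space M. r < E \<omega>} \<omega> \<partial>M)"
    using real by (intro nn_integral_cong) (auto simp: ennreal_less_iff)
  also have "\<dots> = ennreal (exp (- r * \<kappa>))"
    using exponential_distributedD_gt[OF exponential_level real(1)] rate_pos
    by (simp add: emeasure_eq_measure)
  finally show ?thesis using real by (simp add: exp_neg_def mult.commute)
qed simp

lemma nn_integral_indep_level:
  assumes u: "0 \<le> u" and v: "0 \<le> v" and F[measurable]: "F \<in> borel_measurable ((borel \<Otimes>\<^sub>M borel) \<Otimes>\<^sub>M borel)"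
  shows "(\<integral>\<^sup>+\<omega>. F ((\<xi> u \<omega>, \<xi> v \<omega>), E \<omega>) \<partial>M) = (\<integral>\<^sup>+\<omega>. (\<integral>\<^sup>+\<eta>. F ((\<xi> u \<omega>, \<xi> v \<omega>), E \<eta>) \<partial>M) \<partial>M)"
proof -
  have [measurable]: "(\<lambda>x. x w) \<in> measurable (Pi\<^sub>M {0..} (\<lambda>_. borel :: ennreal measure)) borel" if "0 \<le> w" for w :: real
    by (rule measurable_component_singleton) (use that in simp)
  have "(\<lambda>x. (x u, x v)) \<in> measurable (Pi\<^sub>M {0..} (\<lambda>_. borel :: ennreal measure)) (borel \<Otimes>\<^sub>M borel)"
    using u v by measurable
  from nn_integral_of_indep_pair[OF prob_space_axioms indep_level this measurable_ident_sets[OF refl] F]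
  show ?thesis using u v by simp
qed

lemma nn_integral_below_level:
  assumes u: "0 \<le> u" and v: "0 \<le> v" and f[measurable]: "f \<in> borel_measurable borel"
  shows "(\<integral>\<^sup>+\<omega>. (if \<xi> v \<omega> < ennreal (E \<omega>) then f (\<xi> u \<omega>) else 0) \<partial>M) =
    (\<integral>\<^sup>+\<omega>. f (\<xi> u \<omega>) * ennreal (exp_neg \<kappa> (\<xi> v \<omega>)) \<partial>M)"
proof -
  have "(\<integral>\<^sup>+\<omega>. (if \<xi> v \<omega> < ennreal (E \<omega>) then f (\<xi> u \<omega>) else 0) \<partial>M) =
     (\<integral>\<^sup>+\<omega>. (\<lambda>p. f (fst (fst p)) * (if snd (fst p) < ennreal (snd p) then 1 else 0)) ((\<xi> u \<omega>, \<xi> v \<omega>), E \<omega>) \<partial>M)"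
    by (intro nn_integral_cong) auto
  also have "\<dots> = (\<integral>\<^sup>+\<omega>. (\<integral>\<^sup>+\<eta>. (\<lambda>p. f (fst (fst p)) * (if snd (fst p) < ennreal (snd p) then 1 else 0)) ((\<xi> u \<omega>, \<xi> v \<omega>), E \<eta>) \<partial>M) \<partial>M)"
    by (rule nn_integral_indep_level[OF u v]) measurable
  also have "\<dots> = (\<integral>\<^sup>+\<omega>. f (\<xi> u \<omega>) * ennreal (exp_neg \<kappa> (\<xi> v \<omega>)) \<partial>M)"
    by (simp add: nn_integral_cmult nn_integral_level_greater)
  finally show ?thesis .
qed

text \<open>Given the path, the level has a density, and the single point \<open>\<xi>\<^sub>v\<close> has measure zero.\<close>

lemma AE_process_neq_level:
  assumes v: "0 \<le> v" shows "AE \<omega> in M. \<xi> v \<omega> \<noteq> ennreal (E \<omega>)"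
proof -
  have inner: "(\<integral>\<^sup>+\<eta>. (if b = ennreal (E \<eta>) then 1 else 0) \<partial>M) = 0" for b
  proof -
    have "AE \<eta> in M. (if b = ennreal (E \<eta>) then 1 else 0 :: ennreal) = 0"
      using AE_level_pos AE_level_neq[of "enn2real b"] by eventually_elim auto
    then show ?thesis by (subst nn_integral_0_iff_AE) auto
  qed
  have "(\<integral>\<^sup>+\<omega>. (\<lambda>p. if snd (fst p) = ennreal (snd p) then 1 else 0) ((\<xi> v \<omega>, \<xi> v \<omega>), E \<omega>) \<partial>M) =
     (\<integral>\<^sup>+\<omega>. (\<integral>\<^sup>+\<eta>. (\<lambda>p. if snd (fst p) = ennreal (snd p) then 1 else 0) ((\<xi> v \<omega>, \<xi> v \<omega>), E \<eta>) \<partial>M) \<partial>M)"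
    by (rule nn_integral_indep_level[OF v v]) measurable
  then have "(\<integral>\<^sup>+\<omega>. (if \<xi> v \<omega> = ennreal (E \<omega>) then 1 else 0) \<partial>M) = 0"
    by (simp add: inner)
  moreover have [measurable]: "\<xi> v \<in> borel_measurable M" using v by simp
  ultimately have "AE \<omega> in M. (if \<xi> v \<omega> = ennreal (E \<omega>) then 1 else 0 :: ennreal) = 0"
    by (subst (asm) nn_integral_0_iff_AE) auto
  then show ?thesis by eventually_elim (auto split: if_splits)
qed

lemma AE_level_passed:
  assumes pos: "0 < \<phi> \<kappa>" shows "AE \<omega> in M. \<exists>N. ennreal (E \<omega>) \<le> \<xi> (real N) \<omega>"
proof -
  have [measurable]: "\<xi> (real N) \<in> borel_measurable M" for N by simp
  let ?A = "{\<omega> \<in> space M. \<forall>N. \<xi> (real N) \<omega> < ennreal (E \<omega>)}"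
  have "emeasure M ?A \<le> ennreal (exp (- \<phi> \<kappa>) ^ N)" for N
  proof -
    have "emeasure M ?A = (\<integral>\<^sup>+\<omega>. indicator ?A \<omega> \<partial>M)" by simp
    also have "\<dots> \<le> (\<integral>\<^sup>+\<omega>. (if \<xi> (real N) \<omega> < ennreal (E \<omega>) then 1 else 0) \<partial>M)"
      by (intro nn_integral_mono) (auto split: split_indicator)
    also have "\<dots> = (\<integral>\<^sup>+\<omega>. ennreal (exp_neg \<kappa> (\<xi> (real N) \<omega>)) \<partial>M)"
      using nn_integral_below_level[of "real N" "real N" "\<lambda>_. 1"] by simp
    also have "\<dots> = ennreal (exp (- real N * \<phi> \<kappa>))"
      using rate_pos by (simp add: nn_integral_eq_integral integrable_exp_neg expectation_exp_neg)
    finally show ?thesis by (simp flip: exp_of_nat_mult)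
  qed
  moreover have "(\<lambda>N. ennreal (exp (- \<phi> \<kappa>) ^ N)) \<longlonglongrightarrow> ennreal 0"
    by (intro tendsto_ennrealI LIMSEQ_power_zero) (use pos in auto)
  ultimately have "emeasure M ?A \<le> 0"
    by (intro LIMSEQ_le_const[of "\<lambda>N. ennreal (exp (- \<phi> \<kappa>) ^ N)"]) auto
  then show ?thesis
    by (intro AE_I[where N="?A"]) (auto simp: not_le)
qed

text \<open>The crossing event is the difference of the events that the level exceeds \<open>\<xi>\<^sub>u\<close> and that it exceeds
  \<open>\<xi>\<^sub>u\<^sub>+\<^sub>h\<close>; integrating out the level replaces them by the weights \<open>exp_neg \<kappa>\<close> at the two times.\<close>

lemma nn_integral_level_crossing:
  assumes u: "0 \<le> u" and h: "0 \<le> h" and s: "0 \<le> s"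
  shows "(\<integral>\<^sup>+\<omega>. (if \<xi> u \<omega> < ennreal (E \<omega>) \<and> ennreal (E \<omega>) \<le> \<xi> (u + h) \<omega>
      then ennreal (exp_neg s (\<xi> u \<omega>)) else 0) \<partial>M) =
    ennreal (exp (- u * \<phi> (s + \<kappa>)) * (1 - exp (- h * \<phi> \<kappa>)))"
proof -
  have [measurable]: "\<xi> u \<in> borel_measurable M" "\<xi> (u + h) \<in> borel_measurable M" using u h by auto
  have below: "(\<integral>\<^sup>+\<omega>. (if \<xi> (u + r) \<omega> < ennreal (E \<omega>) then ennreal (exp_neg s (\<xi> u \<omega>)) else 0) \<partial>M) =
      ennreal (exp (- u * \<phi> (s + \<kappa>)) * exp (- r * \<phi> \<kappa>))" if r: "0 \<le> r" for r
  proof -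
    have [measurable]: "\<xi> (u + r) \<in> borel_measurable M" using u r by simp
    have "(\<integral>\<^sup>+\<omega>. (if \<xi> (u + r) \<omega> < ennreal (E \<omega>) then ennreal (exp_neg s (\<xi> u \<omega>)) else 0) \<partial>M) =
        (\<integral>\<^sup>+\<omega>. ennreal (exp_neg s (\<xi> u \<omega>)) * ennreal (exp_neg \<kappa> (\<xi> (u + r) \<omega>)) \<partial>M)"
      using u r by (intro nn_integral_below_level) auto
    also have "\<dots> = ennreal (LINT \<omega>|M. exp_neg s (\<xi> u \<omega>) * exp_neg \<kappa> (\<xi> (u + r) \<omega>))"
      unfolding ennreal_mult[OF exp_neg_nonneg exp_neg_nonneg, symmetric]
      by (intro nn_integral_eq_integral integrable_const_bound[where B=1])
        (use s rate_pos exp_neg_le_1 in \<open>auto intro!: mult_le_one\<close>)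
    also have "\<dots> = ennreal (exp (- u * \<phi> (s + \<kappa>)) * exp (- r * \<phi> \<kappa>))"
      using u r s rate_pos by (simp add: expectation_exp_neg_pair expectation_exp_neg)
    finally show ?thesis .
  qed
  let ?I = "\<integral>\<^sup>+\<omega>. (if \<xi> u \<omega> < ennreal (E \<omega>) \<and> ennreal (E \<omega>) \<le> \<xi> (u + h) \<omega>
      then ennreal (exp_neg s (\<xi> u \<omega>)) else 0) \<partial>M"
  have "?I + (\<integral>\<^sup>+\<omega>. (if \<xi> (u + h) \<omega> < ennreal (E \<omega>) then ennreal (exp_neg s (\<xi> u \<omega>)) else 0) \<partial>M) =
      (\<integral>\<^sup>+\<omega>. (if \<xi> (u + 0) \<omega> < ennreal (E \<omega>) then ennreal (exp_neg s (\<xi> u \<omega>)) else 0) \<partial>M)"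
  proof (subst nn_integral_add[symmetric])
    show "(\<integral>\<^sup>+\<omega>. (if \<xi> u \<omega> < ennreal (E \<omega>) \<and> ennreal (E \<omega>) \<le> \<xi> (u + h) \<omega>
          then ennreal (exp_neg s (\<xi> u \<omega>)) else 0)
        + (if \<xi> (u + h) \<omega> < ennreal (E \<omega>) then ennreal (exp_neg s (\<xi> u \<omega>)) else 0) \<partial>M) =
      (\<integral>\<^sup>+\<omega>. (if \<xi> (u + 0) \<omega> < ennreal (E \<omega>) then ennreal (exp_neg s (\<xi> u \<omega>)) else 0) \<partial>M)"
    proof (rule nn_integral_cong)
      fix \<omega> assume "\<omega> \<in> space M"
      from process_mono[OF this u, of "u + h"] h
      show "(if \<xi> u \<omega> < ennreal (E \<omega>) \<and> ennreal (E \<omega>) \<le> \<xi> (u + h) \<omega>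
          then ennreal (exp_neg s (\<xi> u \<omega>)) else 0)
        + (if \<xi> (u + h) \<omega> < ennreal (E \<omega>) then ennreal (exp_neg s (\<xi> u \<omega>)) else 0) =
        (if \<xi> (u + 0) \<omega> < ennreal (E \<omega>) then ennreal (exp_neg s (\<xi> u \<omega>)) else 0)"
        by (auto simp: not_le)
    qed
  qed auto
  then have *: "?I + ennreal (exp (- u * \<phi> (s + \<kappa>)) * exp (- h * \<phi> \<kappa>)) = ennreal (exp (- u * \<phi> (s + \<kappa>)))"
    using below[OF h] below[of 0] by simp
  have "?I = ennreal (exp (- u * \<phi> (s + \<kappa>))) - ennreal (exp (- u * \<phi> (s + \<kappa>)) * exp (- h * \<phi> \<kappa>))"
    unfolding *[symmetric] by simp
  also have "\<dots> = ennreal (exp (- u * \<phi> (s + \<kappa>)) * (1 - exp (- h * \<phi> \<kappa>)))"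
    by (subst ennreal_minus) (auto simp: algebra_simps)
  finally show ?thesis .
qed

text \<open>The crossing intervals of a grid of mesh \<open>h\<close> partition the sample space up to a null set, so the transform of the grid
  position is the geometric series \<open>\<Sum>j. e\<^sup>-\<^sup>j\<^sup>h\<^sup>b (1 - e\<^sup>-\<^sup>h\<^sup>a) = (1 - e\<^sup>-\<^sup>h\<^sup>a) / (1 - e\<^sup>-\<^sup>h\<^sup>b)\<close> with
  \<open>a = \<phi>(\<kappa>)\<close> and \<open>b = \<phi>(s + \<kappa>)\<close>. As \<open>h \<rightarrow> 0\<close>, the grid position tends to the last position and the
  quotient to \<open>a / b\<close>.\<close>

theorem laplace_transform_last_position:
  assumes s: "0 \<le> s" and pos: "0 < \<phi> \<kappa>"
  shows "(\<integral>\<^sup>+\<omega>. ennreal (exp (- s * enn2real (last_position \<xi> (E \<omega>) \<omega>))) \<partial>M) =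
    ennreal (\<phi> \<kappa> / \<phi> (s + \<kappa>))"
proof -
  define a where "a = \<phi> \<kappa>"
  define b where "b = \<phi> (s + \<kappa>)"
  have ab: "0 < a" "0 < b"
    using pos laplace_exponent_mono[of \<kappa> "s + \<kappa>"] rate_pos s by (auto simp: a_def b_def)
  have [measurable]: "\<xi> (real j / real (Suc n)) \<in> borel_measurable M" for j n by simp
  \<comment> \<open>Almost surely exactly one term of this series is nonzero, namely the one of the grid interval
    in which the level is crossed.\<close>
  define Z where "Z n \<omega> = (\<Sum>j. if \<xi> (real j / real (Suc n)) \<omega> < ennreal (E \<omega>) \<and>
      ennreal (E \<omega>) \<le> \<xi> (real (Suc j) / real (Suc n)) \<omega>
    then ennreal (exp_neg s (\<xi> (real j / real (Suc n)) \<omega>)) else 0)" for n \<omega>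
  have Z_int: "(\<integral>\<^sup>+\<omega>. Z n \<omega> \<partial>M) = ennreal ((1 - exp (- (1 / real (Suc n)) * a)) / (1 - exp (- (1 / real (Suc n)) * b)))" for n
  proof -
    define h where "h = 1 / real (Suc n)"
    have h: "0 < h" by (simp add: h_def)
    have "(\<integral>\<^sup>+\<omega>. Z n \<omega> \<partial>M) = (\<Sum>j. ennreal (exp (- (real j / real (Suc n)) * b) * (1 - exp (- h * a))))"
      unfolding Z_def
    proof (subst nn_integral_suminf)
      show "(\<Sum>j. \<integral>\<^sup>+\<omega>. (if \<xi> (real j / real (Suc n)) \<omega> < ennreal (E \<omega>) \<and>
          ennreal (E \<omega>) \<le> \<xi> (real (Suc j) / real (Suc n)) \<omega>
        then ennreal (exp_neg s (\<xi> (real j / real (Suc n)) \<omega>)) else 0) \<partial>M) =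
        (\<Sum>j. ennreal (exp (- (real j / real (Suc n)) * b) * (1 - exp (- h * a))))"
      proof (rule arg_cong[where f=suminf], rule ext)
        fix j
        have "real (Suc j) / real (Suc n) = real j / real (Suc n) + h"
          by (simp add: h_def add_divide_distrib)
        with nn_integral_level_crossing[of "real j / real (Suc n)" h s] h s
        show "(\<integral>\<^sup>+\<omega>. (if \<xi> (real j / real (Suc n)) \<omega> < ennreal (E \<omega>) \<and>
            ennreal (E \<omega>) \<le> \<xi> (real (Suc j) / real (Suc n)) \<omega>
          then ennreal (exp_neg s (\<xi> (real j / real (Suc n)) \<omega>)) else 0) \<partial>M) =
          ennreal (exp (- (real j / real (Suc n)) * b) * (1 - exp (- h * a)))"
          by (simp add: a_def b_def)
      qed
    qed auto
    also have "\<dots> = ennreal ((1 - exp (- h * a)) / (1 - exp (- h * b)))"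
    proof (rule suminf_ennreal_eq)
      have "(\<lambda>j. (1 - exp (- h * a)) * exp (- h * b) ^ j) sums ((1 - exp (- h * a)) * (1 / (1 - exp (- h * b))))"
        by (intro sums_mult geometric_sums) (use h ab in auto)
      moreover have "exp (- h * b) ^ j = exp (- (real j / real (Suc n)) * b)" for j
        by (simp add: h_def exp_of_nat_mult[symmetric])
      ultimately show "(\<lambda>j. exp (- (real j / real (Suc n)) * b) * (1 - exp (- h * a))) sums
          ((1 - exp (- h * a)) / (1 - exp (- h * b)))"
        by (simp add: mult.commute)
    qed (use h ab in auto)
    finally show ?thesis by (simp add: h_def)
  qed
  have Z_lim: "(\<lambda>n. (\<integral>\<^sup>+\<omega>. Z n \<omega> \<partial>M)) \<longlonglongrightarrow> ennreal (a / b)"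
  proof -
    have f: "filterlim (\<lambda>n. 1 / real (Suc n)) (at_right 0) sequentially"
      unfolding filterlim_at using LIMSEQ_inverse_real_of_nat by (simp add: inverse_eq_divide)
    note q = filterlim_compose[OF one_minus_exp_quotient_tendsto f]
    have "(\<lambda>n. ((1 - exp (- (1 / real (Suc n)) * a)) / (1 / real (Suc n))) /
        ((1 - exp (- (1 / real (Suc n)) * b)) / (1 / real (Suc n)))) \<longlonglongrightarrow> a / b"
      by (intro tendsto_divide q) (use ab in auto)
    moreover have "((1 - exp (- (1 / real (Suc n)) * a)) / (1 / real (Suc n))) /
        ((1 - exp (- (1 / real (Suc n)) * b)) / (1 / real (Suc n))) =
        (1 - exp (- (1 / real (Suc n)) * a)) / (1 - exp (- (1 / real (Suc n)) * b))" for n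
      by simp
    ultimately show ?thesis unfolding Z_int by (intro tendsto_ennrealI) (simp only:)
  qed
  have "AE \<omega> in M. \<forall>q\<in>{q\<in>\<rat>. 0 \<le> q}. \<xi> q \<omega> \<noteq> ennreal (E \<omega>)"
    by (subst AE_ball_countable)
      (use AE_process_neq_level countable_rat in \<open>auto intro: countable_subset[of _ \<rat>]\<close>)
  then have Z_AE: "AE \<omega> in M. (\<forall>n. Z n \<omega> \<le> 1) \<and>
      (\<lambda>n. Z n \<omega>) \<longlonglongrightarrow> ennreal (exp (- s * enn2real (last_position \<xi> (E \<omega>) \<omega>)))"
    using AE_level_pos AE_level_passed[OF pos] AE_space
  proof eventually_elim
    case (elim \<omega>)
    note \<omega> = elim(4)
    have "\<exists>j. \<xi> (real j / real (Suc n)) \<omega> < ennreal (E \<omega>) \<and>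
        ennreal (E \<omega>) \<le> \<xi> (real (Suc j) / real (Suc n)) \<omega>" for n
    proof -
      obtain N where "ennreal (E \<omega>) \<le> \<xi> (real N) \<omega>" using elim(3) by blast
      then have ex: "\<exists>i. ennreal (E \<omega>) \<le> \<xi> (real i / real (Suc n)) \<omega>"
        by (intro exI[of _ "N * Suc n"]) (simp del: of_nat_Suc mult_Suc_right)
      define i where "i = (LEAST i. ennreal (E \<omega>) \<le> \<xi> (real i / real (Suc n)) \<omega>)"
      have i: "ennreal (E \<omega>) \<le> \<xi> (real i / real (Suc n)) \<omega>"
        unfolding i_def using ex by (rule LeastI_ex)
      have "i \<noteq> 0"
      proof
        assume "i = 0"
        with i elim(2) show False by (simp add: process_zero[OF \<omega>])
      qed
      then obtain j where j: "i = Suc j" using not0_implies_Suc by blast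
      have "j < i" by (simp add: j)
      then have "\<not> ennreal (E \<omega>) \<le> \<xi> (real j / real (Suc n)) \<omega>"
        unfolding i_def by (rule not_less_Least)
      with i j show ?thesis by (auto simp: not_le)
    qed
    then obtain j where j: "\<And>n. \<xi> (real (j n) / real (Suc n)) \<omega> < ennreal (E \<omega>)"
        "\<And>n. ennreal (E \<omega>) \<le> \<xi> (real (Suc (j n)) / real (Suc n)) \<omega>"
      by metis
    have Zj: "Z n \<omega> = ennreal (exp_neg s (\<xi> (real (j n) / real (Suc n)) \<omega>))" for n
    proof -
      have uniq: "i = j n" if i: "\<xi> (real i / real (Suc n)) \<omega> < ennreal (E \<omega>)"
          "ennreal (E \<omega>) \<le> \<xi> (real (Suc i) / real (Suc n)) \<omega>" for i
      proof (rule ccontr)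
        have less: False if "Suc k \<le> l" "ennreal (E \<omega>) \<le> \<xi> (real (Suc k) / real (Suc n)) \<omega>"
            "\<xi> (real l / real (Suc n)) \<omega> < ennreal (E \<omega>)" for k l
        proof -
          have "real (Suc k) / real (Suc n) \<le> real l / real (Suc n)"
            using that(1) by (intro divide_right_mono) auto
          then have "\<xi> (real (Suc k) / real (Suc n)) \<omega> \<le> \<xi> (real l / real (Suc n)) \<omega>"
            by (intro process_mono[OF \<omega>]) auto
          with that(2,3) show False by (meson leD order_trans)
        qed
        assume "i \<noteq> j n"
        then have "Suc i \<le> j n \<or> Suc (j n) \<le> i" by auto
        then show False using less i j by blast
      qed
      show ?thesis
        unfolding Z_def by (subst suminf_finite[of "{j n}"]) (use uniq j in auto)
    qed
    note lim = grid_position_tendsto[OF \<omega> elim(2) _ j]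
    have fin: "last_position \<xi> (E \<omega>) \<omega> \<noteq> \<top>"
      using lim(2) elim(1) by (metis (no_types, lifting) ennreal_neq_top mem_Collect_eq top_unique)
    have lim_real: "(\<lambda>n. enn2real (\<xi> (real (j n) / real (Suc n)) \<omega>)) \<longlonglongrightarrow>
        enn2real (last_position \<xi> (E \<omega>) \<omega>)"
      by (rule tendsto_enn2real)
        (use lim(1) elim(1) fin in \<open>auto simp: less_top[symmetric] simp del: of_nat_Suc\<close>)
    have fin_j: "exp_neg s (\<xi> (real (j n) / real (Suc n)) \<omega>) =
        exp (- s * enn2real (\<xi> (real (j n) / real (Suc n)) \<omega>))" for n
      using j(1)[of n] by (auto simp: exp_neg_def)
    have "(\<lambda>n. Z n \<omega>) \<longlonglongrightarrow> ennreal (exp (- s * enn2real (last_position \<xi> (E \<omega>) \<omega>)))"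
      unfolding Zj fin_j by (intro tendsto_ennrealI tendsto_exp tendsto_mult_left lim_real)
    moreover have "Z n \<omega> \<le> 1" for n
      unfolding Zj using exp_neg_le_1[OF s] by simp
    ultimately show ?case by blast
  qed
  have [measurable]: "Z n \<in> borel_measurable M" for n unfolding Z_def[abs_def] by measurable
  have [measurable]: "(\<lambda>\<omega>. last_position \<xi> (E \<omega>) \<omega>) \<in> borel_measurable M"
    by (rule measurable_last_position) measurable
  have "(\<lambda>n. (\<integral>\<^sup>+\<omega>. Z n \<omega> \<partial>M)) \<longlonglongrightarrow>
      (\<integral>\<^sup>+\<omega>. ennreal (exp (- s * enn2real (last_position \<xi> (E \<omega>) \<omega>))) \<partial>M)"
    by (rule nn_integral_dominated_convergence[where w="\<lambda>_. 1"])
      (use Z_AE in \<open>auto simp: emeasure_space_1\<close>)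
  from LIMSEQ_unique[OF this Z_lim] show ?thesis by (simp add: a_def b_def)
qed

lemma laplace_transform_of_copy:
  fixes G :: "'b \<Rightarrow> real"
  assumes N: "prob_space N" and [measurable]: "G \<in> borel_measurable N"
    and copy: "distr N borel G = distr M borel (\<lambda>\<omega>. enn2real (last_position \<xi> (E \<omega>) \<omega>))"
    and pos: "0 < \<phi> \<kappa>" and s: "0 \<le> s"
  shows "(\<integral>\<^sup>+\<omega>. ennreal (exp (- s * G \<omega>)) \<partial>N) = ennreal (\<phi> \<kappa> / \<phi> (s + \<kappa>))"
    and "AE \<omega> in N. 0 \<le> G \<omega>"
proof -
  have [measurable]: "(\<lambda>\<omega>. last_position \<xi> (E \<omega>) \<omega>) \<in> borel_measurable M"
    by (rule measurable_last_position) measurable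
  have "(\<integral>\<^sup>+\<omega>. ennreal (exp (- s * G \<omega>)) \<partial>N) = (\<integral>\<^sup>+x. ennreal (exp (- s * x)) \<partial>distr N borel G)"
    by (simp add: nn_integral_distr)
  also have "\<dots> = ennreal (\<phi> \<kappa> / \<phi> (s + \<kappa>))"
    unfolding copy by (simp add: nn_integral_distr laplace_transform_last_position[OF s pos, simplified])
  finally show "(\<integral>\<^sup>+\<omega>. ennreal (exp (- s * G \<omega>)) \<partial>N) = ennreal (\<phi> \<kappa> / \<phi> (s + \<kappa>))" .
  have "AE x in distr N borel G. 0 \<le> x"
    unfolding copy by (subst AE_distr_iff) auto
  then show "AE \<omega> in N. 0 \<le> G \<omega>" by (simp add: AE_distr_iff)
qed

text \<open>The slope at \<open>0\<close> of \<open>s \<mapsto> 1 - \<phi>(\<kappa>) / \<phi>(s + \<kappa>)\<close> is the logarithmic derivative of \<open>\<phi>\<close> at \<open>\<kappa>\<close>.\<close>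

lemma expectation_of_copy:
  fixes G :: "'b \<Rightarrow> real"
  assumes N: "prob_space N" and meas[measurable]: "G \<in> borel_measurable N"
    and copy: "distr N borel G = distr M borel (\<lambda>\<omega>. enn2real (last_position \<xi> (E \<omega>) \<omega>))"
    and pos: "0 < \<phi> \<kappa>"
  shows "has_bochner_integral N G (deriv \<phi> \<kappa> / \<phi> \<kappa>)"
proof (rule prob_space.has_bochner_integral_from_laplace[OF N meas])
  note L = laplace_transform_of_copy[OF N meas copy pos]
  show nonneg: "AE \<omega> in N. 0 \<le> G \<omega>" by (rule L(2)[of 0]) simp
  have pos_s: "0 < \<phi> (s + \<kappa>)" if "0 \<le> s" for s
    using laplace_exponent_mono[of \<kappa> "s + \<kappa>"] pos rate_pos that by simp
  show "(LINT \<omega>|N. exp (- s * G \<omega>)) = \<phi> \<kappa> / \<phi> (s + \<kappa>)" if "0 < s" for s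
    using L(1)[of s] that pos pos_s[of s]
    by (subst integral_eq_nn_integral) auto
  have "((\<lambda>h. (\<phi> (\<kappa> + h) - \<phi> \<kappa>) / h) \<longlongrightarrow> deriv \<phi> \<kappa>) (at_right 0)"
    using laplace_exponent_has_derivative[OF rate_pos] unfolding DERIV_def
    by (rule tendsto_within_subset) simp
  moreover have "((\<lambda>h. \<phi> (\<kappa> + h)) \<longlongrightarrow> \<phi> \<kappa>) (at_right 0)"
  proof -
    have "isCont \<phi> \<kappa>" using laplace_exponent_has_derivative[OF rate_pos] by (rule DERIV_isCont)
    then have "((\<lambda>h. \<phi> (\<kappa> + h)) \<longlongrightarrow> \<phi> \<kappa>) (at 0)" by (simp add: isCont_iff)
    then show ?thesis by (rule tendsto_within_subset) simp
  qed
  ultimately have "((\<lambda>h. ((\<phi> (\<kappa> + h) - \<phi> \<kappa>) / h) / \<phi> (\<kappa> + h)) \<longlongrightarrow> deriv \<phi> \<kappa> / \<phi> \<kappa>) (at_right 0)"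
    by (rule tendsto_divide) (use pos in simp)
  moreover have "\<forall>\<^sub>F h in at_right 0. ((\<phi> (\<kappa> + h) - \<phi> \<kappa>) / h) / \<phi> (\<kappa> + h) = (1 - \<phi> \<kappa> / \<phi> (h + \<kappa>)) / h"
    using eventually_at_right_less[of 0]
  proof eventually_elim
    case (elim h)
    then show ?case using pos_s[of h] by (simp add: field_simps)
  qed
  ultimately show "((\<lambda>s. (1 - \<phi> \<kappa> / \<phi> (s + \<kappa>)) / s) \<longlongrightarrow> deriv \<phi> \<kappa> / \<phi> \<kappa>) (at_right 0)"
    by (subst (asm) tendsto_cong) auto
qed

end

section \<open>Integrals against the harmonic potential measure\<close>

lemma nn_integral_exp_decay:
  assumes "0 \<le> c" and a: "0 < a"
  shows "(\<integral>\<^sup>+t\<in>{0<..}. ennreal (c * exp (- t * a)) \<partial>lborel) = ennreal (c / a)"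
proof -
  have "(\<integral>\<^sup>+t\<in>{0<..}. ennreal (c * exp (- t * a)) \<partial>lborel) =
      (\<integral>\<^sup>+t. ennreal (c * exp (- t * a)) * indicator {0..} t \<partial>lborel)"
  proof (rule nn_integral_cong_AE)
    show "AE t in lborel. ennreal (c * exp (- t * a)) * indicator {0<..} t =
        ennreal (c * exp (- t * a)) * indicator {0..} t"
      using AE_lborel_singleton[of "0::real"] by eventually_elim (auto split: split_indicator)
  qed
  also have "\<dots> = ennreal (0 - (- (c / a) * exp (- 0 * a)))"
  proof (rule nn_integral_FTC_atLeast)
    show "((\<lambda>t. - (c / a) * exp (- t * a)) has_real_derivative c * exp (- t * a)) (at t)" for t
      by (rule derivative_eq_intros refl)+ (use a in auto)
    have "((\<lambda>t. exp (- t * a)) \<longlongrightarrow> 0) at_top"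
    proof (rule filterlim_compose[OF exp_at_bot])
      show "filterlim (\<lambda>t. - t * a) at_bot at_top"
        using filterlim_tendsto_neg_mult_at_bot[OF tendsto_const _ filterlim_ident, of "- a"] a
        by (simp add: mult.commute)
    qed
    then show "((\<lambda>t. - (c / a) * exp (- t * a)) \<longlongrightarrow> 0) at_top"
      by (rule tendsto_mult_right_zero)
  qed (use assms in auto)
  finally show ?thesis by simp
qed

text \<open>The integrand is \<open>e\<^sup>-\<^sup>t\<^sup>u\<close> integrated over \<open>u\<close> in \<open>[a, b]\<close>; exchanging the integrals leaves \<open>1/u\<close>.\<close>

lemma frullani_exp:
  assumes a: "0 < a" and ab: "a \<le> b"
  shows "(\<integral>\<^sup>+t\<in>{0<..}. ennreal ((exp (- t * a) - exp (- t * b)) / t) \<partial>lborel) = ennreal (ln (b / a))"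
proof -
  have inner: "(\<integral>\<^sup>+u\<in>{a..b}. ennreal (exp (- t * u)) \<partial>lborel) = ennreal ((exp (- t * a) - exp (- t * b)) / t)"
    if t: "0 < t" for t :: real
  proof -
    have "(\<integral>\<^sup>+u\<in>{a..b}. ennreal (exp (- t * u)) \<partial>lborel) = ennreal (- exp (- t * b) / t - - exp (- t * a) / t)"
    proof (rule nn_integral_FTC_Icc)
      show "((\<lambda>u. - exp (- t * u) / t) has_real_derivative exp (- t * u)) (at u)" for u
        by (rule derivative_eq_intros refl)+ (use t in auto)
    qed (use ab in auto)
    then show ?thesis by (simp add: diff_divide_distrib)
  qed
  have "(\<integral>\<^sup>+t\<in>{0<..}. ennreal ((exp (- t * a) - exp (- t * b)) / t) \<partial>lborel) =
      (\<integral>\<^sup>+t. (\<integral>\<^sup>+u. ennreal (exp (- t * u)) * indicator {a..b} u * indicator {0<..} t \<partial>lborel) \<partial>lborel)"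
  proof (rule nn_integral_cong)
    fix t :: real
    have "(\<integral>\<^sup>+u. ennreal (exp (- t * u)) * indicator {a..b} u * indicator {0<..} t \<partial>lborel) =
        (\<integral>\<^sup>+u\<in>{a..b}. ennreal (exp (- t * u)) \<partial>lborel) * indicator {0<..} t"
      by (rule nn_integral_multc) simp
    then show "ennreal ((exp (- t * a) - exp (- t * b)) / t) * indicator {0<..} t =
        (\<integral>\<^sup>+u. ennreal (exp (- t * u)) * indicator {a..b} u * indicator {0<..} t \<partial>lborel)"
      using inner[of t] by (cases "0 < t") (simp_all only: indicator_simps greaterThan_iff mult_zero_right not_False_eq_True)
  qed
  also have "\<dots> = (\<integral>\<^sup>+u. (\<integral>\<^sup>+t. ennreal (exp (- t * u)) * indicator {a..b} u * indicator {0<..} t \<partial>lborel) \<partial>lborel)"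
    by (rule lborel_pair.Fubini') measurable
  also have "\<dots> = (\<integral>\<^sup>+u. ennreal (1 / u) * indicator {a..b} u \<partial>lborel)"
  proof (rule nn_integral_cong)
    fix u :: real
    have "(\<integral>\<^sup>+t. ennreal (exp (- t * u)) * indicator {0<..} t \<partial>lborel) = ennreal (1 / u)" if "0 < u"
      using nn_integral_exp_decay[of 1 u] that by simp
    with a show "(\<integral>\<^sup>+t. ennreal (exp (- t * u)) * indicator {a..b} u * indicator {0<..} t \<partial>lborel) =
        ennreal (1 / u) * indicator {a..b} u"
      by (auto split: split_indicator)
  qed
  also have "\<dots> = ennreal (ln b - ln a)"
    by (rule nn_integral_FTC_Icc)
      (use a ab in \<open>auto intro!: derivative_eq_intros\<close>)
  finally show ?thesis using a ab by (simp add: ln_div)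
qed

context subordinator_process
begin

text \<open>By right-continuity, \<open>\<xi>\<^sub>t\<close> is the limit of its values at the next point to the right of \<open>t\<close> on finer
  and finer grids.\<close>

lemma measurable_process_joint:
  "(\<lambda>p. if 0 < fst p then \<xi> (fst p) (snd p) else 0) \<in> borel_measurable (borel \<Otimes>\<^sub>M M)"
proof -
  define u where "u n p = (if 0 < fst p then \<xi> (real (nat \<lfloor>real (Suc n) * fst p\<rfloor> + 1) / real (Suc n)) (snd p) else 0)"
    for n and p :: "real \<times> 'a"
  have "(\<lambda>p. \<xi> (real (nat \<lfloor>real (Suc n) * fst p\<rfloor> + 1) / real (Suc n)) (snd p)) \<in> borel_measurable (borel \<Otimes>\<^sub>M M)" for n
  proof (rule measurable_compose_countable[where g="\<lambda>p. nat \<lfloor>real (Suc n) * fst p\<rfloor>"])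
    fix i :: nat
    have [measurable]: "\<xi> (real (i + 1) / real (Suc n)) \<in> borel_measurable M" by simp
    show "(\<lambda>p. \<xi> (real (i + 1) / real (Suc n)) (snd p)) \<in> borel_measurable (borel \<Otimes>\<^sub>M M)" by measurable
  qed measurable
  then have [measurable]: "u n \<in> borel_measurable (borel \<Otimes>\<^sub>M M)" for n
    unfolding u_def[abs_def] by measurable
  show ?thesis
  proof (rule borel_measurable_LIMSEQ_order[where u=u])
    fix p :: "real \<times> 'a" assume "p \<in> space (borel \<Otimes>\<^sub>M M)"
    then have \<omega>: "snd p \<in> space M" by (auto simp: space_pair_measure)
    show "(\<lambda>n. u n p) \<longlonglongrightarrow> (if 0 < fst p then \<xi> (fst p) (snd p) else 0)"
    proof (cases "0 < fst p")
      case True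
      define v where "v n = real (nat \<lfloor>real (Suc n) * fst p\<rfloor> + 1) / real (Suc n)" for n
      have v: "fst p < v n" "v n \<le> fst p + 1 / real (Suc n)" for n
      proof -
        have "0 \<le> real (Suc n) * fst p" using True by simp
        then have "real (Suc n) * fst p < real (nat \<lfloor>real (Suc n) * fst p\<rfloor> + 1)"
          "real (nat \<lfloor>real (Suc n) * fst p\<rfloor> + 1) \<le> real (Suc n) * fst p + 1" by linarith+
        then show "fst p < v n" "v n \<le> fst p + 1 / real (Suc n)"
          unfolding v_def by (simp_all add: field_simps del: of_nat_Suc of_nat_add)
      qed
      have "v \<longlonglongrightarrow> fst p"
      proof (rule tendsto_sandwich[OF _ _ tendsto_const])
        show "(\<lambda>n. fst p + 1 / real (Suc n)) \<longlonglongrightarrow> fst p"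
          using tendsto_add[OF tendsto_const LIMSEQ_Suc[OF lim_1_over_n], of "fst p"] by simp
      qed (use v in \<open>auto intro!: always_eventually less_imp_le\<close>)
      then have "filterlim v (at_right (fst p)) sequentially"
        unfolding filterlim_at using v by (auto intro!: always_eventually simp: less_imp_neq[symmetric])
      from filterlim_compose[OF process_right_continuous[OF \<omega>, of "fst p"] this] True
      show ?thesis by (simp add: u_def v_def)
    qed (simp add: u_def)
  qed measurable
qed

text \<open>The set function defining the harmonic potential measure is the image, under the position, of
  \<open>dt/t \<otimes> P\<close> restricted to times and paths with \<open>0 < \<xi>\<^sub>t < \<infinity>\<close>. It is therefore a measure, and
  integrals against it are iterated integrals by Tonelli's theorem.\<close>

lemma harmonic_potential_props:
  shows sets_harmonic_potential: "sets (harmonic_potential M \<xi>) = sets borel"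
    and nn_integral_harmonic_potential: "f \<in> borel_measurable borel \<Longrightarrow>
      (\<integral>\<^sup>+x. f x \<partial>harmonic_potential M \<xi>) = (\<integral>\<^sup>+t\<in>{0<..}. ennreal (1 / t) *
        (\<integral>\<^sup>+\<omega>. (if 0 < \<xi> t \<omega> \<and> \<xi> t \<omega> < \<infinity> then f (enn2real (\<xi> t \<omega>)) else 0) \<partial>M) \<partial>lborel)"
proof -
  define X where "X p = (if 0 < fst p then \<xi> (fst p) (snd p) else 0)" for p
  have [measurable]: "X \<in> borel_measurable (borel \<Otimes>\<^sub>M M)"
    using measurable_process_joint by (simp add: X_def[abs_def])
  define w where "w p = indicator {0<..} (fst p) * ennreal (1 / fst p) * (if 0 < X p \<and> X p < \<infinity> then 1 else 0)" for p
  have [measurable]: "w \<in> borel_measurable (borel \<Otimes>\<^sub>M M)" unfolding w_def[abs_def] by measurable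
  define D where "D = distr (density (lborel \<Otimes>\<^sub>M M) w) borel (\<lambda>p. enn2real (X p))"
  have D: "(\<integral>\<^sup>+x. f x \<partial>D) = (\<integral>\<^sup>+t\<in>{0<..}. ennreal (1 / t) *
        (\<integral>\<^sup>+\<omega>. (if 0 < \<xi> t \<omega> \<and> \<xi> t \<omega> < \<infinity> then f (enn2real (\<xi> t \<omega>)) else 0) \<partial>M) \<partial>lborel)"
    if [measurable]: "f \<in> borel_measurable borel" for f :: "real \<Rightarrow> ennreal"
  proof -
    have "(\<integral>\<^sup>+x. f x \<partial>D) = (\<integral>\<^sup>+p. w p * f (enn2real (X p)) \<partial>(lborel \<Otimes>\<^sub>M M))"
      unfolding D_def by (subst nn_integral_distr, simp, simp, subst nn_integral_density) auto
    also have "\<dots> = (\<integral>\<^sup>+t. (\<integral>\<^sup>+\<omega>. w (t, \<omega>) * f (enn2real (X (t, \<omega>))) \<partial>M) \<partial>lborel)"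
      by (subst nn_integral_fst[symmetric]) auto
    also have "\<dots> = (\<integral>\<^sup>+t\<in>{0<..}. ennreal (1 / t) *
        (\<integral>\<^sup>+\<omega>. (if 0 < \<xi> t \<omega> \<and> \<xi> t \<omega> < \<infinity> then f (enn2real (\<xi> t \<omega>)) else 0) \<partial>M) \<partial>lborel)"
    proof (rule nn_integral_cong)
      fix t :: real
      show "(\<integral>\<^sup>+\<omega>. w (t, \<omega>) * f (enn2real (X (t, \<omega>))) \<partial>M) = ennreal (1 / t) *
        (\<integral>\<^sup>+\<omega>. (if 0 < \<xi> t \<omega> \<and> \<xi> t \<omega> < \<infinity> then f (enn2real (\<xi> t \<omega>)) else 0) \<partial>M) * indicator {0<..} t"
      proof (cases "0 < t")
        case True
        then have [measurable]: "\<xi> t \<in> borel_measurable M" by simp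
        show ?thesis
          using True by (subst nn_integral_cmult[symmetric])
            (auto simp: w_def X_def intro!: nn_integral_cong)
      qed (simp add: w_def)
    qed
    finally show ?thesis .
  qed
  have "harmonic_potential M \<xi> = measure_of UNIV (sets borel) (emeasure D)"
    unfolding harmonic_potential_def
  proof (rule measure_of_eq)
    fix A :: "real set" assume "A \<in> sigma_sets UNIV (sets borel)"
    then have [measurable]: "A \<in> sets borel"
      using sets.sigma_sets_eq[of "borel :: real measure"] by simp
    have "emeasure D A = (\<integral>\<^sup>+x. indicator A x \<partial>D)"
      by (subst nn_integral_indicator) (auto simp: D_def)
    also have "\<dots> = (\<integral>\<^sup>+t\<in>{0<..}. ennreal (1 / t) *
        emeasure M {\<omega>\<in>space M. 0 < \<xi> t \<omega> \<and> \<xi> t \<omega> < \<infinity> \<and> enn2real (\<xi> t \<omega>) \<in> A} \<partial>lborel)"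
    proof (subst D, simp, rule nn_integral_cong)
      fix t :: real
      show "ennreal (1 / t) * (\<integral>\<^sup>+\<omega>. (if 0 < \<xi> t \<omega> \<and> \<xi> t \<omega> < \<infinity> then indicator A (enn2real (\<xi> t \<omega>)) else 0) \<partial>M)
          * indicator {0<..} t =
        ennreal (1 / t) * emeasure M {\<omega>\<in>space M. 0 < \<xi> t \<omega> \<and> \<xi> t \<omega> < \<infinity> \<and> enn2real (\<xi> t \<omega>) \<in> A} * indicator {0<..} t"
      proof (cases "0 < t")
        case True
        then have [measurable]: "\<xi> t \<in> borel_measurable M" by simp
        have "(\<integral>\<^sup>+\<omega>. (if 0 < \<xi> t \<omega> \<and> \<xi> t \<omega> < \<infinity> then indicator A (enn2real (\<xi> t \<omega>)) else 0) \<partial>M) =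
          (\<integral>\<^sup>+\<omega>. indicator {\<omega>\<in>space M. 0 < \<xi> t \<omega> \<and> \<xi> t \<omega> < \<infinity> \<and> enn2real (\<xi> t \<omega>) \<in> A} \<omega> \<partial>M)"
          by (intro nn_integral_cong) (auto split: split_indicator)
        then show ?thesis by simp
      qed simp
    qed
    finally show "(\<integral>\<^sup>+t\<in>{0<..}. ennreal (1 / t) *
        emeasure M {\<omega>\<in>space M. 0 < \<xi> t \<omega> \<and> \<xi> t \<omega> < \<infinity> \<and> enn2real (\<xi> t \<omega>) \<in> A} \<partial>lborel) = emeasure D A" ..
  qed simp
  also have "\<dots> = D"
    using measure_of_of_measure[of D] by (simp add: D_def)
  finally have HD: "harmonic_potential M \<xi> = D" .
  show "sets (harmonic_potential M \<xi>) = sets borel" by (simp add: HD D_def)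
  show "f \<in> borel_measurable borel \<Longrightarrow>
      (\<integral>\<^sup>+x. f x \<partial>harmonic_potential M \<xi>) = (\<integral>\<^sup>+t\<in>{0<..}. ennreal (1 / t) *
        (\<integral>\<^sup>+\<omega>. (if 0 < \<xi> t \<omega> \<and> \<xi> t \<omega> < \<infinity> then f (enn2real (\<xi> t \<omega>)) else 0) \<partial>M) \<partial>lborel)"
    unfolding HD by (rule D)
qed

text \<open>The factor \<open>t\<close> in \<open>E \<xi>\<^sub>t e\<^sup>-\<^sup>l\<^sup>\<xi>\<^sup>t = t \<phi>'(l) e\<^sup>-\<^sup>t\<^sup>\<phi>\<^sup>(\<^sup>l\<^sup>)\<close> cancels the density \<open>1/t\<close>, and an exponential
  integral remains.\<close>

lemma set_integral_harmonic_size_biased: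
  assumes l: "0 < l" and pos: "0 < \<phi> l"
  shows "set_integrable (harmonic_potential M \<xi>) {0<..} (\<lambda>x. x * exp (- l * x))"
    and "(LINT x:{0<..}|harmonic_potential M \<xi>. x * exp (- l * x)) = deriv \<phi> l / \<phi> l"
    and "0 \<le> deriv \<phi> l / \<phi> l"
proof -
  let ?H = "harmonic_potential M \<xi>"
  have [measurable_cong]: "sets ?H = sets borel" by (rule sets_harmonic_potential)
  have d: "0 \<le> deriv \<phi> l"
  proof -
    have "0 \<le> (LINT \<omega>|M. enn2real (\<xi> 1 \<omega>) * exp_neg l (\<xi> 1 \<omega>))" by simp
    then show ?thesis by (simp add: expectation_mult_exp_neg[OF l] zero_le_mult_iff)
  qed
  then show nonneg: "0 \<le> deriv \<phi> l / \<phi> l" using pos by simp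
  have inner: "(\<integral>\<^sup>+\<omega>. (if 0 < \<xi> t \<omega> \<and> \<xi> t \<omega> < \<infinity> then ennreal (indicator {0<..} (enn2real (\<xi> t \<omega>)) *
        (enn2real (\<xi> t \<omega>) * exp (- l * enn2real (\<xi> t \<omega>)))) else 0) \<partial>M) =
      ennreal (t * deriv \<phi> l * exp (- t * \<phi> l))" if t: "0 < t" for t
  proof -
    have [measurable]: "\<xi> t \<in> borel_measurable M" using t by simp
    have "(\<integral>\<^sup>+\<omega>. (if 0 < \<xi> t \<omega> \<and> \<xi> t \<omega> < \<infinity> then ennreal (indicator {0<..} (enn2real (\<xi> t \<omega>)) *
        (enn2real (\<xi> t \<omega>) * exp (- l * enn2real (\<xi> t \<omega>)))) else 0) \<partial>M) =
        (\<integral>\<^sup>+\<omega>. ennreal (enn2real (\<xi> t \<omega>) * exp_neg l (\<xi> t \<omega>)) \<partial>M)"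
      by (intro nn_integral_cong) (auto simp: exp_neg_def less_top enn2real_positive_iff)
    also have "\<dots> = ennreal (LINT \<omega>|M. enn2real (\<xi> t \<omega>) * exp_neg l (\<xi> t \<omega>))"
      by (intro nn_integral_eq_integral integrable_mult_exp_neg) (use l in auto)
    finally show ?thesis using t by (simp add: expectation_mult_exp_neg[OF l])
  qed
  have "(\<integral>\<^sup>+x. ennreal (indicator {0<..} x * (x * exp (- l * x))) \<partial>?H) =
      (\<integral>\<^sup>+t\<in>{0<..}. ennreal (deriv \<phi> l * exp (- t * \<phi> l)) \<partial>lborel)"
  proof (subst nn_integral_harmonic_potential, simp, rule nn_integral_cong)
    fix t :: real
    have "ennreal (1 / t) * ennreal (t * deriv \<phi> l * exp (- t * \<phi> l)) = ennreal (deriv \<phi> l * exp (- t * \<phi> l))" if "0 < t"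
      using that d by (simp add: ennreal_mult[symmetric])
    then show "ennreal (1 / t) * (\<integral>\<^sup>+\<omega>. (if 0 < \<xi> t \<omega> \<and> \<xi> t \<omega> < \<infinity> then
        ennreal (indicator {0<..} (enn2real (\<xi> t \<omega>)) *
          (enn2real (\<xi> t \<omega>) * exp (- l * enn2real (\<xi> t \<omega>)))) else 0) \<partial>M) * indicator {0<..} t =
      ennreal (deriv \<phi> l * exp (- t * \<phi> l)) * indicator {0<..} t"
      using inner[of t] by (cases "0 < t") (simp_all only: indicator_simps greaterThan_iff mult_zero_right not_False_eq_True)
  qed
  also have "\<dots> = ennreal (deriv \<phi> l / \<phi> l)" by (rule nn_integral_exp_decay[OF d pos])
  finally have "has_bochner_integral ?H (\<lambda>x. indicator {0<..} x * (x * exp (- l * x))) (deriv \<phi> l / \<phi> l)"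
    by (intro has_bochner_integral_nn_integral nonneg) (auto split: split_indicator)
  then show "set_integrable ?H {0<..} (\<lambda>x. x * exp (- l * x))"
    "(LINT x:{0<..}|?H. x * exp (- l * x)) = deriv \<phi> l / \<phi> l"
    by (simp_all add: set_integrable_def set_lebesgue_integral_def has_bochner_integral_iff)
qed

text \<open>Here \<open>1/t\<close> remains and the time integral is the one of Frullani with \<open>a = \<phi>(l)\<close> and \<open>b = \<phi>(m)\<close>.\<close>

lemma set_integral_harmonic_log_ratio:
  assumes l: "0 \<le> l" and lm: "l \<le> m" and pos: "0 < \<phi> l"
  shows "set_integrable (harmonic_potential M \<xi>) {0<..} (\<lambda>x. exp (- l * x) - exp (- m * x))"
    and "(LINT x:{0<..}|harmonic_potential M \<xi>. exp (- l * x) - exp (- m * x)) = ln (\<phi> m / \<phi> l)"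
proof -
  let ?H = "harmonic_potential M \<xi>"
  have [measurable_cong]: "sets ?H = sets borel" by (rule sets_harmonic_potential)
  have le: "\<phi> l \<le> \<phi> m" using l lm by (rule laplace_exponent_mono)
  have inner: "(\<integral>\<^sup>+\<omega>. (if 0 < \<xi> t \<omega> \<and> \<xi> t \<omega> < \<infinity> then ennreal (indicator {0<..} (enn2real (\<xi> t \<omega>)) *
        (exp (- l * enn2real (\<xi> t \<omega>)) - exp (- m * enn2real (\<xi> t \<omega>)))) else 0) \<partial>M) =
      ennreal (exp (- t * \<phi> l) - exp (- t * \<phi> m))" if t: "0 < t" for t
  proof -
    have [measurable]: "\<xi> t \<in> borel_measurable M" using t by simp
    have "(\<integral>\<^sup>+\<omega>. (if 0 < \<xi> t \<omega> \<and> \<xi> t \<omega> < \<infinity> then ennreal (indicator {0<..} (enn2real (\<xi> t \<omega>)) *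
        (exp (- l * enn2real (\<xi> t \<omega>)) - exp (- m * enn2real (\<xi> t \<omega>)))) else 0) \<partial>M) =
        (\<integral>\<^sup>+\<omega>. ennreal (exp_neg l (\<xi> t \<omega>) - exp_neg m (\<xi> t \<omega>)) \<partial>M)"
      by (intro nn_integral_cong) (auto simp: exp_neg_def less_top enn2real_positive_iff)
    also have "\<dots> = ennreal (LINT \<omega>|M. exp_neg l (\<xi> t \<omega>) - exp_neg m (\<xi> t \<omega>))"
      by (intro nn_integral_eq_integral Bochner_Integration.integrable_diff integrable_exp_neg)
        (use l lm in \<open>auto simp: exp_neg_def intro!: mult_right_mono\<close>)
    finally show ?thesis using t l lm by (simp add: integrable_exp_neg expectation_exp_neg)
  qed
  have "(\<integral>\<^sup>+x. ennreal (indicator {0<..} x * (exp (- l * x) - exp (- m * x))) \<partial>?H) =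
      (\<integral>\<^sup>+t\<in>{0<..}. ennreal ((exp (- t * \<phi> l) - exp (- t * \<phi> m)) / t) \<partial>lborel)"
  proof (subst nn_integral_harmonic_potential, simp, rule nn_integral_cong)
    fix t :: real
    have "ennreal (1 / t) * ennreal (exp (- t * \<phi> l) - exp (- t * \<phi> m)) =
        ennreal ((exp (- t * \<phi> l) - exp (- t * \<phi> m)) / t)" if "0 < t"
      using that le by (simp add: ennreal_mult[symmetric])
    then show "ennreal (1 / t) * (\<integral>\<^sup>+\<omega>. (if 0 < \<xi> t \<omega> \<and> \<xi> t \<omega> < \<infinity> then
        ennreal (indicator {0<..} (enn2real (\<xi> t \<omega>)) *
          (exp (- l * enn2real (\<xi> t \<omega>)) - exp (- m * enn2real (\<xi> t \<omega>)))) else 0) \<partial>M) * indicator {0<..} t =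
      ennreal ((exp (- t * \<phi> l) - exp (- t * \<phi> m)) / t) * indicator {0<..} t"
      using inner[of t] by (cases "0 < t") (simp_all only: indicator_simps greaterThan_iff mult_zero_right not_False_eq_True)
  qed
  also have "\<dots> = ennreal (ln (\<phi> m / \<phi> l))" by (rule frullani_exp[OF pos le])
  finally have "has_bochner_integral ?H (\<lambda>x. indicator {0<..} x * (exp (- l * x) - exp (- m * x))) (ln (\<phi> m / \<phi> l))"
    by (intro has_bochner_integral_nn_integral)
      (use pos le lm in \<open>auto intro!: mult_right_mono split: split_indicator\<close>)
  then show "set_integrable ?H {0<..} (\<lambda>x. exp (- l * x) - exp (- m * x))"
    "(LINT x:{0<..}|?H. exp (- l * x) - exp (- m * x)) = ln (\<phi> m / \<phi> l)"
    by (simp_all add: set_integrable_def set_lebesgue_integral_def has_bochner_integral_iff)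
qed

end

section \<open>The constant and the correction terms\<close>

text \<open>The integrand of the term \<open>B\<^sub>n\<close>.\<close>

definition correction_kernel :: "nat \<Rightarrow> real \<Rightarrow> real" where
  "correction_kernel n x = exp (- x) / (1 - exp (- x)) * (exp (- x) - 1 + x) * exp (- real n * x)"

lemma correction_kernel_bounds:
  assumes x: "0 < x"
  shows "0 \<le> correction_kernel n x" and "correction_kernel n x \<le> x * exp (- real (Suc n) * x)"
proof -
  have 1: "0 < 1 - exp (- x)" using x by simp
  have 2: "0 \<le> exp (- x) - 1 + x" using exp_ge_add_one_self[of "- x"] by linarith
  show "0 \<le> correction_kernel n x" unfolding correction_kernel_def using 1 2 by simp
  have "(1 + x) * exp (- x) \<le> exp x * exp (- x)"
    by (intro mult_right_mono) auto
  also have "\<dots> = 1" by (rule exp_minus_inverse)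
  finally have "exp (- x) - 1 + x \<le> x * (1 - exp (- x))"
    by (simp add: algebra_simps)
  then have "(exp (- x) - 1 + x) / (1 - exp (- x)) \<le> x" using 1 by (simp add: divide_le_eq)
  then have "(exp (- x) - 1 + x) / (1 - exp (- x)) * exp (- real (Suc n) * x) \<le> x * exp (- real (Suc n) * x)"
    by (rule mult_right_mono) simp
  moreover have "correction_kernel n x = (exp (- x) - 1 + x) / (1 - exp (- x)) * exp (- real (Suc n) * x)"
  proof -
    have "exp (- real (Suc n) * x) = exp (- real n * x) * exp (- x)"
      by (simp add: exp_add[symmetric] algebra_simps)
    then show ?thesis by (simp add: correction_kernel_def del: of_nat_Suc)
  qed
  ultimately show "correction_kernel n x \<le> x * exp (- real (Suc n) * x)" by simp
qed

text \<open>The kernel depends on \<open>n\<close> through \<open>e\<^sup>-\<^sup>n\<^sup>x\<close> only, so that the difference cancels its denominator.\<close>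

lemma correction_kernel_diff:
  assumes x: "0 < x"
  shows "correction_kernel n x - correction_kernel (Suc n) x =
    x * exp (- real (Suc n) * x) - (exp (- real (Suc n) * x) - exp (- real (Suc (Suc n)) * x))"
proof -
  have "exp (- x) \<noteq> 1" using x by simp
  have e: "exp (- real (Suc k) * x) = exp (- real k * x) * exp (- x)" for k
    by (simp add: exp_add[symmetric] algebra_simps)
  define y where "y = exp (- x)"
  define z where "z = exp (- real n * x)"
  have y: "1 - y \<noteq> 0" using x by (simp add: y_def)
  have "correction_kernel n x - correction_kernel (Suc n) x = y / (1 - y) * (y - 1 + x) * z - y / (1 - y) * (y - 1 + x) * (z * y)"
    unfolding correction_kernel_def e y_def z_def ..
  also have "\<dots> = y / (1 - y) * (1 - y) * ((y - 1 + x) * z)" by (simp only: algebra_simps)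
  also have "\<dots> = y * ((y - 1 + x) * z)" using y by simp
  also have "\<dots> = x * (z * y) - (z * y - z * y * y)" by (simp add: algebra_simps)
  finally show ?thesis unfolding e y_def z_def .
qed

locale nontrivial_subordinator = subordinator_process +
  assumes nontrivial: "\<exists>l\<ge>0. \<phi> l \<noteq> 0"
begin

abbreviation H :: "real measure" where "H \<equiv> harmonic_potential M \<xi>"

lemma sets_H[measurable_cong]: "sets H = sets borel" by (rule sets_harmonic_potential)

lemma exponent_pos: "1 \<le> l \<Longrightarrow> 0 < \<phi> l" using laplace_exponent_pos[OF nontrivial] .

lemma log_derivative_tendsto_0: "(\<lambda>n. deriv \<phi> (real (Suc n)) / \<phi> (real (Suc n))) \<longlonglongrightarrow> 0"
proof -
  have "(\<lambda>n. LINT x|H. indicator {0<..} x *\<^sub>R (x * exp (- real (Suc n) * x))) \<longlonglongrightarrow> (LINT x|H. 0)"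
  proof (rule integral_dominated_convergence[where w="\<lambda>x. indicator {0<..} x *\<^sub>R (x * exp (- 1 * x))"])
    show "integrable H (\<lambda>x. indicator {0<..} x *\<^sub>R (x * exp (- 1 * x)))"
      using set_integral_harmonic_size_biased(1)[of 1] exponent_pos[of 1] by (simp add: set_integrable_def)
    show "AE x in H. norm (indicator {0<..} x *\<^sub>R (x * exp (- real (Suc n) * x))) \<le>
        indicator {0<..} x *\<^sub>R (x * exp (- 1 * x))" for n
    proof (rule AE_I2)
      fix x :: real
      have "- real (Suc n) * x \<le> - 1 * x" if "0 < x" using that by (simp add: field_simps)
      then show "norm (indicator {0<..} x *\<^sub>R (x * exp (- real (Suc n) * x))) \<le>
        indicator {0<..} x *\<^sub>R (x * exp (- 1 * x))"
        by (cases "0 < x") (auto simp del: of_nat_Suc)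
    qed
    show "AE x in H. (\<lambda>n. indicator {0<..} x *\<^sub>R (x * exp (- real (Suc n) * x))) \<longlonglongrightarrow> 0"
    proof (rule AE_I2)
      fix x :: real
      show "(\<lambda>n. indicator {0<..} x *\<^sub>R (x * exp (- real (Suc n) * x))) \<longlonglongrightarrow> 0"
      proof (cases "0 < x")
        case True
        have "(\<lambda>n. x * exp (- x) ^ Suc n) \<longlonglongrightarrow> x * 0"
          by (intro tendsto_mult_left LIMSEQ_Suc LIMSEQ_power_zero) (use True in simp)
        moreover have "exp (- x) ^ Suc n = exp (- real (Suc n) * x)" for n
          using exp_of_nat_mult[of "Suc n" "- x"] by (simp del: of_nat_Suc power_Suc)
        ultimately show ?thesis using True by (simp del: of_nat_Suc power_Suc)
      qed simp
    qed
  qed measurable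
  moreover have "(LINT x|H. indicator {0<..} x *\<^sub>R (x * exp (- real (Suc n) * x))) =
      deriv \<phi> (real (Suc n)) / \<phi> (real (Suc n))" for n
    using set_integral_harmonic_size_biased(2)[of "real (Suc n)"] exponent_pos[of "real (Suc n)"]
    by (simp add: set_lebesgue_integral_def)
  ultimately show ?thesis by simp
qed

text \<open>Integrate \<open>1 - e\<^sup>-\<^sup>x \<le> x\<close> with the weight \<open>e\<^sup>-\<^sup>(\<^sup>n\<^sup>+\<^sup>1\<^sup>)\<^sup>x\<close>. The estimate gives \<open>\<phi>(n+2) / \<phi>(n+1) \<rightarrow> 1\<close>
  for bounded and for unbounded \<open>\<phi>\<close> alike.\<close>

lemma log_increment_le: "ln (\<phi> (real (Suc (Suc n))) / \<phi> (real (Suc n))) \<le> deriv \<phi> (real (Suc n)) / \<phi> (real (Suc n))"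
proof -
  have "(LINT x:{0<..}|H. exp (- real (Suc n) * x) - exp (- real (Suc (Suc n)) * x)) \<le>
      (LINT x:{0<..}|H. x * exp (- real (Suc n) * x))"
  proof (rule set_integral_mono)
    fix x :: real assume "x \<in> {0<..}"
    have "exp (- real (Suc (Suc n)) * x) = exp (- real (Suc n) * x) * exp (- x)"
      by (simp add: exp_add[symmetric] algebra_simps)
    then have "exp (- real (Suc n) * x) - exp (- real (Suc (Suc n)) * x) = exp (- real (Suc n) * x) * (1 - exp (- x))"
      by (simp add: right_diff_distrib)
    also have "\<dots> \<le> exp (- real (Suc n) * x) * x"
      using exp_ge_add_one_self[of "- x"] by (intro mult_left_mono) auto
    finally show "exp (- real (Suc n) * x) - exp (- real (Suc (Suc n)) * x) \<le> x * exp (- real (Suc n) * x)"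
      by (simp add: mult.commute)
  qed (use set_integral_harmonic_log_ratio(1)[of "real (Suc n)" "real (Suc (Suc n))"]
        set_integral_harmonic_size_biased(1)[of "real (Suc n)"] exponent_pos[of "real (Suc n)"] in auto)
  then show ?thesis
    using set_integral_harmonic_log_ratio(2)[of "real (Suc n)" "real (Suc (Suc n))"]
      set_integral_harmonic_size_biased(2)[of "real (Suc n)"] exponent_pos[of "real (Suc n)"] by simp
qed

lemma ratio_tendsto_1: "(\<lambda>n. \<phi> (real (Suc (Suc n))) / \<phi> (real (Suc n))) \<longlonglongrightarrow> 1"
  and log_ratio_tendsto_0: "(\<lambda>n. ln (\<phi> (real (Suc (Suc n))) / \<phi> (real (Suc n)))) \<longlonglongrightarrow> 0"
proof -
  have ge: "1 \<le> \<phi> (real (Suc (Suc n))) / \<phi> (real (Suc n))" for n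
    using laplace_exponent_mono[of "real (Suc n)" "real (Suc (Suc n))"] exponent_pos[of "real (Suc n)"] by simp
  show lim: "(\<lambda>n. ln (\<phi> (real (Suc (Suc n))) / \<phi> (real (Suc n)))) \<longlonglongrightarrow> 0"
    by (rule tendsto_sandwich[OF _ _ tendsto_const log_derivative_tendsto_0])
      (use ge log_increment_le in \<open>auto intro!: always_eventually simp del: of_nat_Suc\<close>)
  have "(\<lambda>n. exp (ln (\<phi> (real (Suc (Suc n))) / \<phi> (real (Suc n))))) \<longlonglongrightarrow> exp 0"
    by (intro tendsto_exp lim)
  moreover have "exp (ln (\<phi> (real (Suc (Suc n))) / \<phi> (real (Suc n)))) = \<phi> (real (Suc (Suc n))) / \<phi> (real (Suc n))" for n
    using less_le_trans[OF zero_less_one ge[of n]] by (rule exp_ln)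
  ultimately show "(\<lambda>n. \<phi> (real (Suc (Suc n))) / \<phi> (real (Suc n))) \<longlonglongrightarrow> 1" by (simp del: of_nat_Suc)
qed

definition correction :: "nat \<Rightarrow> real" where
  "correction n = (LINT x:{0<..}|H. correction_kernel n x)"

lemma set_integrable_correction_kernel: "set_integrable H {0<..} (correction_kernel n)"
proof -
  have "set_integrable H {0<..} (\<lambda>x. x * exp (- real (Suc n) * x))"
    using set_integral_harmonic_size_biased(1)[of "real (Suc n)"] exponent_pos[of "real (Suc n)"] by simp
  then show ?thesis
    unfolding set_integrable_def
  proof (rule Bochner_Integration.integrable_bound)
    show "AE x in H. norm (indicator {0<..} x *\<^sub>R correction_kernel n x) \<le>
        norm (indicator {0<..} x *\<^sub>R (x * exp (- real (Suc n) * x)))"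
    proof (rule AE_I2)
      fix x :: real
      show "norm (indicator {0<..} x *\<^sub>R correction_kernel n x) \<le> norm (indicator {0<..} x *\<^sub>R (x * exp (- real (Suc n) * x)))"
        using correction_kernel_bounds[of x n] by (cases "0 < x") (auto simp del: of_nat_Suc)
    qed
  qed (unfold correction_kernel_def, measurable)
qed

lemma correction_tendsto_0: "correction \<longlonglongrightarrow> 0"
proof (rule tendsto_sandwich[OF _ _ tendsto_const log_derivative_tendsto_0])
  have "0 \<le> correction n" for n
    unfolding correction_def set_lebesgue_integral_def
    by (rule integral_nonneg_AE) (auto simp: correction_kernel_bounds split: split_indicator)
  then show "\<forall>\<^sub>F n in sequentially. 0 \<le> correction n" by (simp add: always_eventually)
  have "correction n \<le> deriv \<phi> (real (Suc n)) / \<phi> (real (Suc n))" for n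
  proof -
    have "correction n \<le> (LINT x:{0<..}|H. x * exp (- real (Suc n) * x))"
      unfolding correction_def
      by (rule set_integral_mono[OF set_integrable_correction_kernel])
        (use set_integral_harmonic_size_biased(1)[of "real (Suc n)"] exponent_pos[of "real (Suc n)"]
          correction_kernel_bounds(2) in \<open>auto simp del: of_nat_Suc\<close>)
    then show ?thesis
      using set_integral_harmonic_size_biased(2)[of "real (Suc n)"] exponent_pos[of "real (Suc n)"] by simp
  qed
  then show "\<forall>\<^sub>F n in sequentially. correction n \<le> deriv \<phi> (real (Suc n)) / \<phi> (real (Suc n))"
    by (simp add: always_eventually del: of_nat_Suc)
qed

lemma correction_diff:
  "correction n - correction (Suc n) = deriv \<phi> (real (Suc n)) / \<phi> (real (Suc n)) - ln (\<phi> (real (Suc (Suc n))) / \<phi> (real (Suc n)))"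
proof -
  note [simp del] = of_nat_Suc
  have p: "0 < \<phi> (real (Suc n))" by (rule exponent_pos) simp
  note a = set_integral_harmonic_size_biased[OF _ p]
  note b = set_integral_harmonic_log_ratio[OF _ _ p, of "real (Suc (Suc n))"]
  have "correction n - correction (Suc n) = (LINT x:{0<..}|H. correction_kernel n x - correction_kernel (Suc n) x)"
    unfolding correction_def by (rule set_integral_diff(2)[symmetric]) (rule set_integrable_correction_kernel)+
  also have "\<dots> = (LINT x:{0<..}|H. x * exp (- real (Suc n) * x) -
      (exp (- real (Suc n) * x) - exp (- real (Suc (Suc n)) * x)))"
    by (rule set_lebesgue_integral_cong) (auto simp: sets_H correction_kernel_diff)
  also have "\<dots> = (LINT x:{0<..}|H. x * exp (- real (Suc n) * x)) -
      (LINT x:{0<..}|H. exp (- real (Suc n) * x) - exp (- real (Suc (Suc n)) * x))"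
    by (rule set_integral_diff(2)) (use a(1) b(1) in auto)
  also have "\<dots> = deriv \<phi> (real (Suc n)) / \<phi> (real (Suc n)) - ln (\<phi> (real (Suc (Suc n))) / \<phi> (real (Suc n)))"
    using a(2) b(2) by simp
  finally show ?thesis .
qed

text \<open>The right-hand side does not change from \<open>n\<close> to \<open>n + 1\<close>. Because the correction tends to \<open>0\<close>, the
  remaining terms converge to this common value, and replacing \<open>\<phi>(n+1)\<close> by \<open>\<phi>(n)\<close> in them does not
  affect the limit.\<close>

lemma gamma_const_eq:
  "gamma_const \<phi> = (\<Sum>k=1..n. deriv \<phi> (real k) / \<phi> (real k)) - ln (\<phi> (real (Suc n))) + correction n"
proof -
  define a where "a n = (\<Sum>k=1..n. deriv \<phi> (real k) / \<phi> (real k)) - ln (\<phi> (real (Suc n)))" for n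
  have step: "a (Suc n) + correction (Suc n) = a n + correction n" for n
    using correction_diff[of n] exponent_pos[of "real (Suc n)"] exponent_pos[of "real (Suc (Suc n))"]
    by (simp add: a_def ln_div del: of_nat_Suc)
  have const: "a n + correction n = a 0 + correction 0" for n
    by (induction n) (simp_all add: step)
  have "(\<lambda>n. (a 0 + correction 0) - correction n) \<longlonglongrightarrow> (a 0 + correction 0) - 0"
    by (intro tendsto_diff tendsto_const correction_tendsto_0)
  moreover have "(a 0 + correction 0) - correction n = a n" for n using const[of n] by simp
  ultimately have a_lim: "a \<longlonglongrightarrow> a 0 + correction 0" by simp
  define c where "c n = (\<Sum>j=1..n. deriv \<phi> (real j) / \<phi> (real j)) - ln (\<phi> (real n))" for n
  have "c (Suc n) = a (Suc n) + ln (\<phi> (real (Suc (Suc n))) / \<phi> (real (Suc n)))" for n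
    using exponent_pos[of "real (Suc n)"] exponent_pos[of "real (Suc (Suc n))"] by (simp add: a_def c_def ln_div del: of_nat_Suc)
  moreover have "(\<lambda>n. a (Suc n) + ln (\<phi> (real (Suc (Suc n))) / \<phi> (real (Suc n)))) \<longlonglongrightarrow> (a 0 + correction 0) + 0"
    by (intro tendsto_add LIMSEQ_Suc[OF a_lim] log_ratio_tendsto_0)
  ultimately have "c \<longlonglongrightarrow> a 0 + correction 0"
    by (simp add: filterlim_sequentially_Suc[of c, symmetric] del: of_nat_Suc)
  then have "gamma_const \<phi> = a 0 + correction 0"
    unfolding gamma_const_def c_def by (rule limI)
  with const[of n] show ?thesis by (simp add: a_def)
qed

end

section \<open>Factorisation of the remainder variable\<close>

text \<open>By \<open>e\<^sup>\<epsilon> + e\<^sup>-\<^sup>\<epsilon> \<ge> 2\<close>, one constant serves for large and for small values of \<open>y\<close>.\<close>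

lemma abs_ln_gt_imp:
  fixes y e :: real
  assumes y: "0 < y" and e: "0 < e" and "\<bar>ln y\<bar> > e"
  shows "1 - exp (- e) \<le> \<bar>y - 1\<bar>"
proof (cases "ln y > e")
  case True
  then have "exp e < y" using y by (metis exp_less_cancel_iff exp_ln)
  moreover have "2 \<le> exp e + exp (- e)"
    using exp_ge_add_one_self[of e] exp_ge_add_one_self[of "- e"] by linarith
  ultimately show ?thesis by linarith
next
  case False
  then have "ln y < - e" using assms(3) by linarith
  then have "y < exp (- e)" using y by (metis exp_less_cancel_iff exp_ln)
  then show ?thesis by linarith
qed

lemma remainder_variable_moment:
  "remainder_variable N R \<psi> \<Longrightarrow> has_bochner_integral N (\<lambda>\<omega>. R \<omega> ^ n) (\<Prod>i=1..n. \<psi> (real i))"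
  by (cases "n = 0") (auto simp: remainder_variable_def prob_space.prob_space has_bochner_integral_iff
      prob_space.finite_measure finite_measure.integrable_const)

context nontrivial_subordinator
begin

lemma prod_laplace_exponent_le: "(\<Prod>i=1..n. \<phi> (real i)) \<le> \<phi> 1 ^ n * fact n"
proof (induction n)
  case (Suc n)
  have "(\<Prod>i=1..Suc n. \<phi> (real i)) = (\<Prod>i=1..n. \<phi> (real i)) * \<phi> (real (Suc n))" by simp
  also have "\<dots> \<le> (\<phi> 1 ^ n * fact n) * (real (Suc n) * \<phi> 1)"
    using Suc laplace_exponent_le_mult[of "Suc n"] exponent_pos[of 1] exponent_pos[of "real (Suc n)"]
    by (intro mult_mono) auto
  finally show ?case by (simp add: algebra_simps)
qed simp

text \<open>The quotient \<open>R\<^sub>n / \<phi>(n+1)\<close> has mean \<open>1\<close> and variance \<open>\<phi>(n+2) / \<phi>(n+1) - 1\<close>.\<close>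

lemma log_remainder_tendsto_0_in_probability:
  assumes Rn: "\<And>n. n \<ge> 1 \<Longrightarrow> remainder_variable N (Rn n) (\<lambda>l. \<phi> (l + real n))" and e: "0 < e"
  shows "(\<lambda>n. measure N {\<omega>\<in>space N. \<bar>ln (Rn n \<omega> / \<phi> (real n + 1))\<bar> > e}) \<longlonglongrightarrow> 0"
proof -
  define d where "d = 1 - exp (- e)"
  have d: "0 < d" using e by (simp add: d_def)
  have bound: "measure N {\<omega>\<in>space N. \<bar>ln (Rn (Suc n) \<omega> / \<phi> (real (Suc n) + 1))\<bar> > e} \<le>
      (\<phi> (real (Suc (Suc (Suc n)))) / \<phi> (real (Suc (Suc n))) - 1) / d\<^sup>2" for n
  proof -
    define p where "p = \<phi> (real (Suc n) + 1)"
    define q where "q = \<phi> (real (Suc n) + 2)"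
    have p: "0 < p" unfolding p_def by (rule exponent_pos) simp
    have rv: "remainder_variable N (Rn (Suc n)) (\<lambda>l. \<phi> (l + real (Suc n)))" by (rule Rn) simp
    interpret N: prob_space N using rv by (simp add: remainder_variable_def)
    define Y where "Y \<omega> = Rn (Suc n) \<omega> / p" for \<omega>
    have [measurable]: "Rn (Suc n) \<in> borel_measurable N" using rv by (simp add: remainder_variable_def)
    have [measurable]: "Y \<in> borel_measurable N" unfolding Y_def[abs_def] by measurable
    have Y_pos: "AE \<omega> in N. 0 < Y \<omega>"
      using rv p by (auto simp: remainder_variable_def Y_def elim!: eventually_mono)
    have "has_bochner_integral N (\<lambda>\<omega>. Rn (Suc n) \<omega>) p"
      using remainder_variable_moment[OF rv, of 1] by (simp add: p_def add.commute)
    then have Y1: "integrable N Y" "N.expectation Y = 1"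
      using p by (auto simp: Y_def[abs_def] has_bochner_integral_iff)
    have "has_bochner_integral N (\<lambda>\<omega>. (Rn (Suc n) \<omega>)\<^sup>2) (p * q)"
      using remainder_variable_moment[OF rv, of 2] by (simp add: p_def q_def numeral_2_eq_2 add_ac)
    then have Y2: "integrable N (\<lambda>\<omega>. (Y \<omega>)\<^sup>2)" "N.expectation (\<lambda>\<omega>. (Y \<omega>)\<^sup>2) = q / p"
      using p by (auto simp: Y_def has_bochner_integral_iff power_divide power2_eq_square)
    have "measure N {\<omega>\<in>space N. \<bar>ln (Y \<omega>)\<bar> > e} \<le> measure N {\<omega>\<in>space N. d \<le> \<bar>Y \<omega> - N.expectation Y\<bar>}"
    proof (rule N.finite_measure_mono_AE)
      show "AE \<omega> in N. \<omega> \<in> {\<omega>\<in>space N. \<bar>ln (Y \<omega>)\<bar> > e} \<longrightarrow> \<omega> \<in> {\<omega>\<in>space N. d \<le> \<bar>Y \<omega> - N.expectation Y\<bar>}"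
        using Y_pos
      proof eventually_elim
        case (elim \<omega>)
        then show ?case using abs_ln_gt_imp[OF elim e] by (auto simp: Y1 d_def)
      qed
    qed measurable
    also have "\<dots> \<le> N.variance Y / d\<^sup>2"
      by (rule N.Chebyshev_inequality) (use Y2(1) d in auto)
    also have "N.variance Y = q / p - 1"
      using N.variance_eq[OF Y1(1) Y2(1)] Y1 Y2 by simp
    finally show ?thesis by (simp add: Y_def p_def q_def add_ac)
  qed
  have "(\<lambda>n. (\<phi> (real (Suc (Suc (Suc n)))) / \<phi> (real (Suc (Suc n))) - 1) / d\<^sup>2) \<longlonglongrightarrow> (1 - 1) / d\<^sup>2"
    by (intro tendsto_intros LIMSEQ_Suc[OF ratio_tendsto_1]) (use d in simp)
  then have upper: "(\<lambda>n. (\<phi> (real (Suc (Suc (Suc n)))) / \<phi> (real (Suc (Suc n))) - 1) / d\<^sup>2) \<longlonglongrightarrow> 0" by simp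
  have "(\<lambda>n. measure N {\<omega>\<in>space N. \<bar>ln (Rn (Suc n) \<omega> / \<phi> (real (Suc n) + 1))\<bar> > e}) \<longlonglongrightarrow> 0"
    by (rule tendsto_sandwich[OF _ _ tendsto_const upper])
      (use bound in \<open>auto intro!: always_eventually simp del: of_nat_Suc\<close>)
  then show ?thesis by (rule LIMSEQ_imp_Suc)
qed

text \<open>By independence the moment is the product of \<open>\<phi>(n+1) \<dots> \<phi>(n+m)\<close> and the fractions
  \<open>\<phi>(k) / \<phi>(m+k)\<close>, \<open>k \<le> n\<close>. Extending both numerator and denominator to products from \<open>1\<close> to
  \<open>n + m\<close> shows the cancellation.\<close>

lemma remainder_factorization_moment:
  fixes G :: "nat \<Rightarrow> 'b \<Rightarrow> real"
  assumes N: "prob_space N"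
    and G_indep: "prob_space.indep_vars N (\<lambda>_. borel) G {1..n}"
    and G_laplace: "\<And>k s. k \<in> {1..n} \<Longrightarrow> 0 \<le> s \<Longrightarrow>
      (\<integral>\<^sup>+\<omega>. ennreal (exp (- s * G k \<omega>)) \<partial>N) = ennreal (\<phi> (real k) / \<phi> (s + real k))"
    and R: "remainder_variable N R (\<lambda>l. \<phi> (l + real n))"
    and R_indep: "indep_pair N (Pi\<^sub>M {1..n} (\<lambda>_. borel)) (\<lambda>\<omega>. \<lambda>k\<in>{1..n}. G k \<omega>) borel R"
  shows "has_bochner_integral N (\<lambda>\<omega>. (R \<omega> * exp (- (\<Sum>k=1..n. G k \<omega>))) ^ m) (\<Prod>i=1..m. \<phi> (real i))"
proof -
  interpret N: prob_space N by fact
  have G_meas[measurable]: "G k \<in> borel_measurable N" if "k \<in> {1..n}" for k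
    using G_indep that by (auto simp: N.indep_vars_def)
  have [measurable]: "R \<in> borel_measurable N" and R_pos: "AE \<omega> in N. 0 < R \<omega>"
    using R by (auto simp: remainder_variable_def)
  have [measurable]: "(\<lambda>\<omega>. \<Sum>k=1..n. G k \<omega>) \<in> borel_measurable N" by measurable
  have ppos: "0 < \<phi> (real i + real j)" if "1 \<le> i \<or> 1 \<le> j" for i j using that by (intro exponent_pos) auto
  have ppos1: "0 < \<phi> (real i)" if "1 \<le> i" for i using that by (intro exponent_pos) auto
  have prod_pos_aux: "0 < (\<Prod>i\<in>{1..j}. \<phi> (real i))" for j by (intro prod_pos) (auto intro: ppos1)
  have shift: "(\<Prod>i=1..a. \<phi> (real i + real b)) * (\<Prod>i=1..b. \<phi> (real i)) = (\<Prod>i=1..a + b. \<phi> (real i))" for a b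
    by (induction a) (auto simp: algebra_simps)
  have "(\<integral>\<^sup>+\<omega>. ennreal ((R \<omega> * exp (- (\<Sum>k=1..n. G k \<omega>))) ^ m) \<partial>N) =
      (\<integral>\<^sup>+\<omega>. (\<lambda>p. ennreal (fst p) * ennreal (snd p))
        ((\<lambda>x. \<Prod>k=1..n. exp (- real m * x k)) (\<lambda>k\<in>{1..n}. G k \<omega>), (\<lambda>r. r ^ m) (R \<omega>)) \<partial>N)"
  proof (rule nn_integral_cong_AE)
    show "AE \<omega> in N. ennreal ((R \<omega> * exp (- (\<Sum>k=1..n. G k \<omega>))) ^ m) = (\<lambda>p. ennreal (fst p) * ennreal (snd p))
        ((\<lambda>x. \<Prod>k=1..n. exp (- real m * x k)) (\<lambda>k\<in>{1..n}. G k \<omega>), (\<lambda>r. r ^ m) (R \<omega>))"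
      using R_pos
    proof eventually_elim
      case (elim \<omega>)
      have "exp (- (\<Sum>k=1..n. G k \<omega>)) ^ m = (\<Prod>k=1..n. exp (- real m * G k \<omega>))"
        by (simp add: exp_sum[symmetric] exp_of_nat_mult[symmetric] sum_distrib_left sum_negf)
      then show ?case using elim
        by (simp add: power_mult_distrib ennreal_mult[symmetric] prod_nonneg mult.commute cong: prod.cong_simp)
    qed
  qed
  also have "\<dots> = (\<integral>\<^sup>+\<omega>. (\<integral>\<^sup>+\<eta>. ennreal (\<Prod>k=1..n. exp (- real m * G k \<omega>)) * ennreal (R \<eta> ^ m) \<partial>N) \<partial>N)"
  proof -
    have 1: "(\<lambda>x. \<Prod>k=1..n. exp (- real m * x k)) \<in> borel_measurable (Pi\<^sub>M {1..n} (\<lambda>_. borel :: real measure))"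
      by measurable
    have 2: "(\<lambda>r :: real. r ^ m) \<in> borel_measurable borel" by measurable
    have 3: "(\<lambda>p. ennreal (fst p) * ennreal (snd p)) \<in> borel_measurable (borel \<Otimes>\<^sub>M borel)" by measurable
    show ?thesis
      by (subst nn_integral_of_indep_pair[OF N R_indep 1 2 3]) (simp cong: prod.cong_simp)
  qed
  also have "\<dots> = (\<integral>\<^sup>+\<omega>. ennreal (\<Prod>k=1..n. exp (- real m * G k \<omega>)) \<partial>N) * (\<integral>\<^sup>+\<eta>. ennreal (R \<eta> ^ m) \<partial>N)"
    by (subst nn_integral_cmult, simp, subst nn_integral_multc) auto
  also have "(\<integral>\<^sup>+\<omega>. ennreal (\<Prod>k=1..n. exp (- real m * G k \<omega>)) \<partial>N) = ennreal (\<Prod>k=1..n. \<phi> (real k) / \<phi> (real m + real k))"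
  proof -
    have "N.indep_vars (\<lambda>_. borel) (\<lambda>k \<omega>. ennreal (exp (- real m * G k \<omega>))) {1..n}"
      by (rule N.indep_vars_compose2[OF G_indep, where Y="\<lambda>_ x. ennreal (exp (- real m * x))"]) measurable
    then have "(\<integral>\<^sup>+\<omega>. (\<Prod>k=1..n. ennreal (exp (- real m * G k \<omega>))) \<partial>N) =
        (\<Prod>k=1..n. (\<integral>\<^sup>+\<omega>. ennreal (exp (- real m * G k \<omega>)) \<partial>N))"
      by (intro N.indep_vars_nn_integral) auto
    also have "\<dots> = (\<Prod>k=1..n. ennreal (\<phi> (real k) / \<phi> (real m + real k)))"
      by (intro prod.cong G_laplace) auto
    also have "\<dots> = ennreal (\<Prod>k=1..n. \<phi> (real k) / \<phi> (real m + real k))"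
      by (rule prod_ennreal) (auto intro!: divide_nonneg_nonneg less_imp_le[OF ppos] less_imp_le[OF ppos1])
    finally show ?thesis by (simp add: prod_ennreal prod_nonneg)
  qed
  also have "(\<integral>\<^sup>+\<eta>. ennreal (R \<eta> ^ m) \<partial>N) = ennreal (\<Prod>i=1..m. \<phi> (real i + real n))"
    using remainder_variable_moment[OF R, of m] R_pos
    by (subst nn_integral_eq_integral) (auto simp: has_bochner_integral_iff elim!: eventually_mono)
  also have "ennreal (\<Prod>k=1..n. \<phi> (real k) / \<phi> (real m + real k)) * ennreal (\<Prod>i=1..m. \<phi> (real i + real n)) =
      ennreal (\<Prod>i=1..m. \<phi> (real i))"
  proof -
    have "(\<Prod>k=1..n. \<phi> (real k) / \<phi> (real m + real k)) * (\<Prod>i=1..m. \<phi> (real i + real n)) =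
       (\<Prod>k=1..n. \<phi> (real k)) * (\<Prod>i=1..m. \<phi> (real i + real n)) / (\<Prod>k=1..n. \<phi> (real k + real m))"
      by (simp add: prod_dividef add.commute)
    also have "\<dots> = (\<Prod>i=1..n + m. \<phi> (real i)) / (\<Prod>k=1..n. \<phi> (real k + real m))"
      using shift[of n m] by (simp add: mult.commute add.commute)
    also have "\<dots> = (\<Prod>i=1..m. \<phi> (real i))"
    proof -
      have "0 < (\<Prod>k=1..n. \<phi> (real k + real m))"
        by (intro prod_pos) (auto intro: ppos)
      then have "(\<Prod>k=1..n. \<phi> (real k + real m)) \<noteq> 0" by (rule less_imp_neq[symmetric])
      then show ?thesis
        unfolding shift[of m n, symmetric] by (rule nonzero_mult_div_cancel_left)
    qed
    finally show ?thesis
      by (subst ennreal_mult[symmetric]) (auto intro!: prod_nonneg simp: less_imp_le ppos ppos1)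
  qed
  finally have nn: "(\<integral>\<^sup>+\<omega>. ennreal ((R \<omega> * exp (- (\<Sum>k=1..n. G k \<omega>))) ^ m) \<partial>N) = ennreal (\<Prod>i=1..m. \<phi> (real i))" .
  show ?thesis
    by (rule has_bochner_integral_nn_integral)
      (use nn R_pos prod_pos_aux[of m] in \<open>auto intro: less_imp_le elim!: eventually_mono\<close>)
qed

end

theorem corollary3:
  fixes M :: "'a measure" and \<xi> :: "real \<Rightarrow> 'a \<Rightarrow> ennreal" and e :: "nat \<Rightarrow> 'a \<Rightarrow> real"
    and \<phi> :: "real \<Rightarrow> real" and H :: "real measure"
    and N :: "'b measure" and G :: "nat \<Rightarrow> 'b \<Rightarrow> real" and Rn :: "nat \<Rightarrow> 'b \<Rightarrow> real"
    and Q :: "'c measure" and R :: "'c \<Rightarrow> real" and B :: "nat \<Rightarrow> real"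
  assumes sub: "subordinator M \<xi>"
    and phi: "\<phi> = laplace_exponent M \<xi>"
    and nontrivial: "\<exists>l\<ge>0. \<phi> l \<noteq> 0"
    and H: "H = harmonic_potential M \<xi>"
    and R: "remainder_variable Q R \<phi>"
    and e_exp: "\<And>k. k \<ge> 1 \<Longrightarrow> distributed M lborel (e k) (exponential_density (real k))"
    and e_indep: "\<And>k. k \<ge> 1 \<Longrightarrow>
      indep_pair M (Pi\<^sub>M {0..} (\<lambda>_. borel)) (\<lambda>\<omega>. \<lambda>t\<in>{0..}. \<xi> t \<omega>) borel (e k)"
    and N: "prob_space N"
    and G_indep: "prob_space.indep_vars N (\<lambda>_. borel) G {1..}"
    and G_copy: "\<And>k. k \<ge> 1 \<Longrightarrow>
      distr N borel (G k) = distr M borel (\<lambda>\<omega>. enn2real (last_position \<xi> (e k \<omega>) \<omega>))"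
    and Rn: "\<And>n. n \<ge> 1 \<Longrightarrow> remainder_variable N (Rn n) (\<lambda>l. \<phi> (l + real n))"
    and Rn_indep: "\<And>n. n \<ge> 1 \<Longrightarrow>
      indep_pair N (Pi\<^sub>M {1..n} (\<lambda>_. borel)) (\<lambda>\<omega>. \<lambda>k\<in>{1..n}. G k \<omega>) borel (Rn n)"
    and B: "B = (\<lambda>n. LINT x:{0<..}|H.
      exp (- x) / (1 - exp (- x)) * (exp (- x) - 1 + x) * exp (- real n * x))"
  shows "(\<forall>n\<ge>1.
      set_integrable H {0<..}
        (\<lambda>x. exp (- x) / (1 - exp (- x)) * (exp (- x) - 1 + x) * exp (- real n * x)) \<and>
      distr Q borel (\<lambda>\<omega>. ln (R \<omega>)) =
      distr N borel (\<lambda>\<omega>. - gamma_const \<phi>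
        + (\<Sum>k=1..n. (LINT \<omega>'|N. G k \<omega>') - G k \<omega>)
        + ln (Rn n \<omega> / \<phi> (real n + 1)) + B n)) \<and>
    (\<forall>\<epsilon>>0. (\<lambda>n. measure N {\<omega>\<in>space N. \<bar>ln (Rn n \<omega> / \<phi> (real n + 1))\<bar> > \<epsilon>}) \<longlonglongrightarrow> 0) \<and>
    B \<longlonglongrightarrow> 0"
proof -
  interpret M: nontrivial_subordinator M \<xi>
    using sub nontrivial unfolding phi
    by (intro nontrivial_subordinator.intro subordinator_process.intro nontrivial_subordinator_axioms.intro
        subordinator_process_axioms.intro) (auto simp: subordinator_def)
  interpret N: prob_space N by fact
  interpret Q: prob_space Q using R by (simp add: remainder_variable_def)
  have level: "subordinator_exponential_level M \<xi> (real k) (e k)" if "k \<ge> 1" for k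
    using that e_exp[OF that] e_indep[OF that] by unfold_locales auto
  have G_meas: "G k \<in> borel_measurable N" if "k \<ge> 1" for k
    using G_indep that by (auto simp: N.indep_vars_def)
  have phi_pos: "0 < laplace_exponent M \<xi> (real k)" if "k \<ge> 1" for k
    using M.exponent_pos[of "real k"] that by simp
  have G_mean: "(LINT \<omega>|N. G k \<omega>) = deriv \<phi> (real k) / \<phi> (real k)" if "k \<ge> 1" for k
    using subordinator_exponential_level.expectation_of_copy[OF level[OF that] N G_meas[OF that]
        G_copy[OF that] phi_pos[OF that]]
    by (simp add: phi has_bochner_integral_iff)
  have B_eq: "B = M.correction"
    unfolding B H by (simp add: fun_eq_iff M.correction_def correction_kernel_def)
  have law: "distr Q borel (\<lambda>\<omega>. ln (R \<omega>)) =
      distr N borel (\<lambda>\<omega>. - gamma_const \<phi>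
        + (\<Sum>k=1..n. (LINT \<omega>'|N. G k \<omega>') - G k \<omega>)
        + ln (Rn n \<omega> / \<phi> (real n + 1)) + B n)" if n: "n \<ge> 1" for n
  proof -
    have Rn_rv: "remainder_variable N (Rn n) (\<lambda>l. laplace_exponent M \<xi> (l + real n))"
      using Rn[OF n] by (simp add: phi)
    have R_meas[measurable]: "R \<in> borel_measurable Q" and R_pos: "AE \<omega> in Q. 0 < R \<omega>"
      using R by (auto simp: remainder_variable_def)
    have Rn_meas[measurable]: "Rn n \<in> borel_measurable N" and Rn_pos: "AE \<omega> in N. 0 < Rn n \<omega>"
      using Rn_rv by (auto simp: remainder_variable_def)
    have [measurable]: "G k \<in> borel_measurable N" if "k \<in> {1..n}" for k using that G_meas by simp
    define X where "X \<omega> = Rn n \<omega> * exp (- (\<Sum>k=1..n. G k \<omega>))" for \<omega>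
    have [measurable]: "(\<lambda>\<omega>. \<Sum>k=1..n. G k \<omega>) \<in> borel_measurable N" by measurable
    have X_meas[measurable]: "X \<in> borel_measurable N" unfolding X_def[abs_def] by measurable
    have R_moment: "has_bochner_integral Q (\<lambda>\<omega>. R \<omega> ^ m) (\<Prod>i=1..m. \<phi> (real i))" for m
      by (rule remainder_variable_moment[OF R])
    have X_moment: "has_bochner_integral N (\<lambda>\<omega>. X \<omega> ^ m) (\<Prod>i=1..m. \<phi> (real i))" for m
      unfolding X_def phi
    proof (rule M.remainder_factorization_moment[OF N _ _ Rn_rv Rn_indep[OF n]])
      show "N.indep_vars (\<lambda>_. borel) G {1..n}" by (rule N.indep_vars_subset[OF G_indep]) auto
      fix k :: nat and s :: real assume k: "k \<in> {1..n}" and s: "0 \<le> s"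
      then have "k \<ge> 1" by simp
      from subordinator_exponential_level.laplace_transform_of_copy(1)[OF level[OF this] N G_meas[OF this]
          G_copy[OF this] phi_pos[OF this] s]
      show "(\<integral>\<^sup>+\<omega>. ennreal (exp (- s * G k \<omega>)) \<partial>N) =
          ennreal (laplace_exponent M \<xi> (real k) / laplace_exponent M \<xi> (s + real k))" .
    qed
    \<comment> \<open>The moments of both variables are the same and grow slowly enough to determine the law.\<close>
    have RX: "distr Q borel R = distr N borel X"
    proof (rule distr_eqI_moments[OF Q.prob_space_axioms N R_meas X_meas _ _ R_moment X_moment])
      show "AE \<omega> in Q. 0 \<le> R \<omega>" using R_pos by eventually_elim simp
      show "AE \<omega> in N. 0 \<le> X \<omega>" using Rn_pos by eventually_elim (simp add: X_def)
      show "(\<Prod>i=1..m. \<phi> (real i)) \<le> \<phi> 1 ^ m * fact m" for m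
        using M.prod_laplace_exponent_le by (simp add: phi)
      show "0 < \<phi> 1" using M.exponent_pos[of 1] by (simp add: phi)
    qed
    have "distr Q borel (\<lambda>\<omega>. ln (R \<omega>)) = distr (distr Q borel R) borel ln"
      by (subst distr_distr) (auto simp: comp_def)
    also have "\<dots> = distr N borel (\<lambda>\<omega>. ln (X \<omega>))"
      unfolding RX by (subst distr_distr) (auto simp: comp_def)
    also have "\<dots> = distr N borel (\<lambda>\<omega>. - gamma_const \<phi>
        + (\<Sum>k=1..n. (LINT \<omega>'|N. G k \<omega>') - G k \<omega>)
        + ln (Rn n \<omega> / \<phi> (real n + 1)) + B n)"
    proof (rule distr_cong_AE)
      \<comment> \<open>This is what makes the constants on the right-hand side cancel.\<close>
      have gamma: "gamma_const \<phi> = (\<Sum>k=1..n. LINT \<omega>'|N. G k \<omega>') - ln (\<phi> (real n + 1)) + B n"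
        using M.gamma_const_eq[of n] G_mean by (simp add: phi B_eq add.commute)
      show "AE \<omega> in N. ln (X \<omega>) = - gamma_const \<phi>
        + (\<Sum>k=1..n. (LINT \<omega>'|N. G k \<omega>') - G k \<omega>)
        + ln (Rn n \<omega> / \<phi> (real n + 1)) + B n"
        using Rn_pos
      proof eventually_elim
        case (elim \<omega>)
        have "ln (X \<omega>) = ln (Rn n \<omega>) - (\<Sum>k=1..n. G k \<omega>)"
          unfolding X_def using elim by (simp add: ln_mult)
        moreover have "ln (Rn n \<omega> / \<phi> (real n + 1)) = ln (Rn n \<omega>) - ln (\<phi> (real n + 1))"
          using elim M.exponent_pos[of "real n + 1"] by (simp add: ln_div phi)
        ultimately show ?case
          unfolding gamma sum_subtractf by simp
      qed
    qed auto
    finally show ?thesis .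
  qed
  have integrable: "set_integrable H {0<..}
      (\<lambda>x. exp (- x) / (1 - exp (- x)) * (exp (- x) - 1 + x) * exp (- real n * x))" for n
    using M.set_integrable_correction_kernel[of n] unfolding H correction_kernel_def .
  have prob: "(\<lambda>n. measure N {\<omega>\<in>space N. \<bar>ln (Rn n \<omega> / \<phi> (real n + 1))\<bar> > \<epsilon>}) \<longlonglongrightarrow> 0"
    if "\<epsilon> > 0" for \<epsilon>
    unfolding phi
    by (rule M.log_remainder_tendsto_0_in_probability[OF _ that]) (use Rn in \<open>simp add: phi\<close>)
  show ?thesis using law integrable prob M.correction_tendsto_0 unfolding B_eq by blast
qed

end
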